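(* Given a D&C SPN over $x=(x_1,\dots,x_n)$ of size $s$ and arbitrary depth, there exists a D&C SPN of size $O(s^3)$ and depth $O(\log(n)\log(s))$ which computes the same function.
   Context: Arithmetic circuits: an arithmetic circuit $\Phi$ over a tuple of variables $y$ is a finite directed acyclic graph with a unique node of out-degree $0$ (the root). Each node of in-degree $0$ is labeled by a variable of $y$ or a real constant; every other node is labeled $\times$ (product node) or $+$ (sum node), and edges into sum nodes carry real weights. In-degrees and out-degrees are unbounded. The children $C(u)$ of $u$ are the nodes with an edge into $u$. Labeled leaves compute their labels, a product node computes $q_u=\prod_{v\in C(u)}q_v$, a sum node computes $q_u=\sum_{v\in C(u)}w_{v,u}q_v$; $q_\Phi$ is the polynomial computed by the root. $\Phi$ is monotone if all weights and constants are non-negative. The size is the number of nodes; the depth is the length of the longest directed path. SPNs: let $x=(x_1,\dots,x_n)$, $x_i\in R_i\subseteq\mathbb{R}$ with measures $M_i$ on $R_i$, and let $f$ be a tuple of non-negative univariate functions $f_{i,j}(x_i)$, each with finite $M_i$-integral. A Sum Product Network (SPN) is a monotone arithmetic circuit over $f$; it computes the function $x\mapsto q_\Phi(f(x))$. The dependency-scope of a node $u$ is the set of those $x_i$ such that some $f_{i,j}$ labels a node in the sub-circuit rooted at $u$. An SPN is decomposable if for every product node the dependency-scopes of its children are pairwise disjoint, complete if for every sum node the dependency-scopes of its children are all equal, and a D&C SPN if it is both. *)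

theory Defs
  imports "HOL-Analysis.Analysis" "HOL-Library.Poly_Mapping"
begin

text \<open>Multivariate real polynomials in variables of type \<open>'y\<close>: finitely supported
  maps from monomials (finitely supported exponent vectors) to coefficients.\<close>

type_synonym 'y mpoly = "('y \<Rightarrow>\<^sub>0 nat) \<Rightarrow>\<^sub>0 real"

definition mpoly_const :: "real \<Rightarrow> 'y mpoly" where
  "mpoly_const c = Poly_Mapping.single 0 c"

definition mpoly_var :: "'y \<Rightarrow> 'y mpoly" where
  "mpoly_var y = Poly_Mapping.single (Poly_Mapping.single y 1) 1"

definition mpoly_eval :: "'y mpoly \<Rightarrow> ('y \<Rightarrow> real) \<Rightarrow> real" where
  "mpoly_eval p a = (\<Sum>m\<in>Poly_Mapping.keys p.
     Poly_Mapping.lookup p m * (\<Prod>y\<in>Poly_Mapping.keys m. a y ^ Poly_Mapping.lookup m y))"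


datatype 'y label = Var 'y | Const real | Prod | Sum

text \<open>A pair \<open>(v, u)\<close> in \<open>edges\<close> is an edge from the child \<open>v\<close> to its parent \<open>u\<close>.
  The value of \<open>weight\<close> matters only on edges into sum nodes.\<close>

record ('v, 'y) circuit =
  nodes :: "'v set"
  edges :: "('v \<times> 'v) set"
  label :: "'v \<Rightarrow> 'y label"
  weight :: "'v \<times> 'v \<Rightarrow> real"

definition children :: "('v, 'y) circuit \<Rightarrow> 'v \<Rightarrow> 'v set" where
  "children \<Phi> u = {v. (v, u) \<in> edges \<Phi>}"

definition is_root :: "('v, 'y) circuit \<Rightarrow> 'v \<Rightarrow> bool" where
  "is_root \<Phi> u \<longleftrightarrow> u \<in> nodes \<Phi> \<and> (\<forall>w. (u, w) \<notin> edges \<Phi>)"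

definition root :: "('v, 'y) circuit \<Rightarrow> 'v" where
  "root \<Phi> = (THE u. is_root \<Phi> u)"

definition arithmetic_circuit :: "'y set \<Rightarrow> ('v, 'y) circuit \<Rightarrow> bool" where
  "arithmetic_circuit Y \<Phi> \<longleftrightarrow>
     finite (nodes \<Phi>) \<and> edges \<Phi> \<subseteq> nodes \<Phi> \<times> nodes \<Phi> \<and> acyclic (edges \<Phi>) \<and>
     (\<exists>!u. is_root \<Phi> u) \<and>
     (\<forall>u\<in>nodes \<Phi>. if children \<Phi> u = {} then label \<Phi> u \<in> Var ` Y \<union> range Const
                   else label \<Phi> u \<in> {Prod, Sum})"

text \<open>The polynomial computed at a node, by recursion along the edge relation.\<close>

definition node_poly :: "('v, 'y) circuit \<Rightarrow> 'v \<Rightarrow> 'y mpoly" where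
  "node_poly \<Phi> = wfrec (edges \<Phi>) (\<lambda>q u.
     case label \<Phi> u of
       Var y \<Rightarrow> mpoly_var y
     | Const c \<Rightarrow> mpoly_const c
     | Prod \<Rightarrow> (\<Prod>v\<in>children \<Phi> u. q v)
     | Sum \<Rightarrow> (\<Sum>v\<in>children \<Phi> u. mpoly_const (weight \<Phi> (v, u)) * q v))"

lemma node_poly_rec:
  assumes "arithmetic_circuit Y \<Phi>"
  shows "node_poly \<Phi> u =
    (case label \<Phi> u of
       Var y \<Rightarrow> mpoly_var y
     | Const c \<Rightarrow> mpoly_const c
     | Prod \<Rightarrow> (\<Prod>v\<in>children \<Phi> u. node_poly \<Phi> v)
     | Sum \<Rightarrow> (\<Sum>v\<in>children \<Phi> u. mpoly_const (weight \<Phi> (v, u)) * node_poly \<Phi> v))"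
proof -
  have "finite (edges \<Phi>)"
    using assms by (auto simp: arithmetic_circuit_def intro: finite_subset)
  then have "wf (edges \<Phi>)"
    using assms by (auto simp: arithmetic_circuit_def intro: finite_acyclic_wf)
  then show ?thesis
    unfolding node_poly_def
    by (subst wfrec) (auto simp: children_def cut_apply split: label.split)
qed

definition circuit_poly :: "('v, 'y) circuit \<Rightarrow> 'y mpoly" where
  "circuit_poly \<Phi> = node_poly \<Phi> (root \<Phi>)"

definition monotone_circuit :: "('v, 'y) circuit \<Rightarrow> bool" where
  "monotone_circuit \<Phi> \<longleftrightarrow>
     (\<forall>u\<in>nodes \<Phi>. \<forall>c. label \<Phi> u = Const c \<longrightarrow> 0 \<le> c) \<and>
     (\<forall>u\<in>nodes \<Phi>. label \<Phi> u = Sum \<longrightarrow> (\<forall>v\<in>children \<Phi> u. 0 \<le> weight \<Phi> (v, u)))"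

definition circuit_size :: "('v, 'y) circuit \<Rightarrow> nat" where
  "circuit_size \<Phi> = card (nodes \<Phi>)"

definition is_path :: "('v, 'y) circuit \<Rightarrow> 'v list \<Rightarrow> bool" where
  "is_path \<Phi> p \<longleftrightarrow> p \<noteq> [] \<and> set p \<subseteq> nodes \<Phi> \<and> successively (\<lambda>u v. (u, v) \<in> edges \<Phi>) p"

text \<open>Path length is the number of edges.\<close>

definition circuit_depth :: "('v, 'y) circuit \<Rightarrow> nat" where
  "circuit_depth \<Phi> = Max {length p - 1 | p. is_path \<Phi> p}"


text \<open>The input functions: the tuple \<open>f\<close> consists of the functions \<open>f i j\<close> of the variable
  \<open>x i\<close>, for \<open>i \<in> {1..n}\<close> and \<open>j \<in> {1..k i}\<close>. Values of \<open>f\<close> at other indices are irrelevant.\<close>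

definition input_functions ::
  "nat \<Rightarrow> (nat \<Rightarrow> real set) \<Rightarrow> (nat \<Rightarrow> real measure) \<Rightarrow> (nat \<Rightarrow> nat) \<Rightarrow> (nat \<Rightarrow> nat \<Rightarrow> real \<Rightarrow> real) \<Rightarrow> bool"
where
  "input_functions n R M k f \<longleftrightarrow>
     (\<forall>i\<in>{1..n}. space (M i) = R i \<and>
        (\<forall>j\<in>{1..k i}. (\<forall>t\<in>R i. 0 \<le> f i j t) \<and> integrable (M i) (f i j)))"

definition input_indices :: "nat \<Rightarrow> (nat \<Rightarrow> nat) \<Rightarrow> (nat \<times> nat) set" where
  "input_indices n k = (SIGMA i:{1..n}. {1..k i})"

definition spn :: "nat \<Rightarrow> (nat \<Rightarrow> nat) \<Rightarrow> ('v, nat \<times> nat) circuit \<Rightarrow> bool" where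
  "spn n k \<Phi> \<longleftrightarrow> arithmetic_circuit (input_indices n k) \<Phi> \<and> monotone_circuit \<Phi>"

definition spn_fun ::
  "(nat \<Rightarrow> nat \<Rightarrow> real \<Rightarrow> real) \<Rightarrow> ('v, nat \<times> nat) circuit \<Rightarrow> (nat \<Rightarrow> real) \<Rightarrow> real" where
  "spn_fun f \<Phi> x = mpoly_eval (circuit_poly \<Phi>) (\<lambda>(i, j). f i j (x i))"

text \<open>The scope is given by the indices \<open>i\<close> of the variables \<open>x i\<close>; the nodes of the
  sub-circuit rooted at \<open>u\<close> are those with a directed path to \<open>u\<close>.\<close>

definition dep_scope :: "('v, nat \<times> nat) circuit \<Rightarrow> 'v \<Rightarrow> nat set" where
  "dep_scope \<Phi> u = {i. \<exists>v j. (v, u) \<in> (edges \<Phi>)\<^sup>* \<and> label \<Phi> v = Var (i, j)}"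

definition decomposable :: "('v, nat \<times> nat) circuit \<Rightarrow> bool" where
  "decomposable \<Phi> \<longleftrightarrow> (\<forall>u\<in>nodes \<Phi>. label \<Phi> u = Prod \<longrightarrow>
     disjoint_family_on (dep_scope \<Phi>) (children \<Phi> u))"

definition complete_spn :: "('v, nat \<times> nat) circuit \<Rightarrow> bool" where
  "complete_spn \<Phi> \<longleftrightarrow> (\<forall>u\<in>nodes \<Phi>. label \<Phi> u = Sum \<longrightarrow>
     (\<forall>v\<in>children \<Phi> u. \<forall>w\<in>children \<Phi> u. dep_scope \<Phi> v = dep_scope \<Phi> w))"

definition dc_spn :: "nat \<Rightarrow> (nat \<Rightarrow> nat) \<Rightarrow> ('v, nat \<times> nat) circuit \<Rightarrow> bool" where
  "dc_spn n k \<Phi> \<longleftrightarrow> spn n k \<Phi> \<and> decomposable \<Phi> \<and> complete_spn \<Phi>"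

end

theory Submission
  imports Defs "HOL-Library.Log_Nat"
begin

text \<open>
  Completeness and decomposability make every node set-multilinear over its scope, so the number of
  variables in the scope acts as a degree and the depth reduction of Valiant, Skyum, Berkowitz and
  Rackoff applies. For nodes \<open>v\<close> below \<open>u\<close> let \<open>quot u v\<close> be the partial derivative of
  \<open>u\<close> with respect to \<open>v\<close>. Cutting at the nodes \<open>w\<close> where the degree drops from above to at
  most \<open>m\<close> gives \<open>u = (\<Sum>w. quot u w * w)\<close> and \<open>quot u v = (\<Sum>w. quot u w * quot w v)\<close>. With
  \<open>m\<close> halfway, all factors on the right (after expanding \<open>w\<close> and \<open>quot w v\<close> at the product
  node \<open>w\<close>) have half the degree, except for values of nodes whose degree is at most that of
  \<open>quot u v\<close>; those are halved one step later. Since fan-in is unbounded, the depth is even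
  \<open>O(log n)\<close>, and the products \<open>quot u w * quot w v\<close> account for the \<open>O(s\<^sup>3)\<close> nodes.
\<close>

subsection \<open>Evaluation, scope and depth of circuits\<close>

definition monom_eval :: "('y \<Rightarrow> real) \<Rightarrow> ('y \<Rightarrow>\<^sub>0 nat) \<Rightarrow> real" where
  "monom_eval a m = (\<Prod>y\<in>Poly_Mapping.keys m. a y ^ Poly_Mapping.lookup m y)"

text \<open>Indices outside the support contribute the factor \<open>a y ^ 0 = 1\<close>, so
  monomials with different supports can be evaluated over a common index set.\<close>

lemma monom_eval_superset:
  assumes "finite A" "Poly_Mapping.keys m \<subseteq> A"
  shows "monom_eval a m = (\<Prod>y\<in>A. a y ^ Poly_Mapping.lookup m y)"
  unfolding monom_eval_def
  by (rule prod.mono_neutral_left) (use assms in \<open>auto simp: in_keys_iff\<close>)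

lemma monom_eval_add: "monom_eval a (m + m') = monom_eval a m * monom_eval a m'"
proof -
  let ?A = "Poly_Mapping.keys m \<union> Poly_Mapping.keys m'"
  have "Poly_Mapping.keys (m + m') \<subseteq> ?A"
    by (rule keys_add)
  then show ?thesis
    by (simp add: monom_eval_superset[of ?A] lookup_add power_add prod.distrib)
qed

lemma mpoly_eval_superset:
  assumes "finite A" "Poly_Mapping.keys p \<subseteq> A"
  shows "mpoly_eval p a = (\<Sum>m\<in>A. Poly_Mapping.lookup p m * monom_eval a m)"
  unfolding mpoly_eval_def monom_eval_def
  by (rule sum.mono_neutral_left) (use assms in \<open>auto simp: in_keys_iff\<close>)

lemma mpoly_eval_single: "mpoly_eval (Poly_Mapping.single m c) a = c * monom_eval a m"
  by (simp add: mpoly_eval_superset[of "{m}"])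

lemma mpoly_eval_zero: "mpoly_eval 0 a = 0"
  by (simp add: mpoly_eval_def)

lemma mpoly_eval_add: "mpoly_eval (p + q) a = mpoly_eval p a + mpoly_eval q a"
proof -
  let ?A = "Poly_Mapping.keys p \<union> Poly_Mapping.keys q"
  have "Poly_Mapping.keys (p + q) \<subseteq> ?A"
    by (rule keys_add)
  then show ?thesis
    by (simp add: mpoly_eval_superset[of ?A] lookup_add algebra_simps sum.distrib)
qed

lemma mpoly_eval_sum: "mpoly_eval (sum p A) a = (\<Sum>x\<in>A. mpoly_eval (p x) a)"
  by (induction A rule: infinite_finite_induct) (auto simp: mpoly_eval_zero mpoly_eval_add)

lemma sum_single_lookup:
  "p = (\<Sum>m\<in>Poly_Mapping.keys p. Poly_Mapping.single m (Poly_Mapping.lookup p m))"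
  by (rule poly_mapping_eqI)
    (auto simp: lookup_sum lookup_single when_def in_keys_iff)

lemma mpoly_eval_mult: "mpoly_eval (p * q) a = mpoly_eval p a * mpoly_eval q a"
proof -
  \<comment> \<open>Both factors are split into single terms, since a product of two single terms is
    again one, with added exponents.\<close>
  have "p * q = (\<Sum>m\<in>Poly_Mapping.keys p. \<Sum>m'\<in>Poly_Mapping.keys q.
      Poly_Mapping.single (m + m') (Poly_Mapping.lookup p m * Poly_Mapping.lookup q m'))"
    using arg_cong2[OF sum_single_lookup[of p] sum_single_lookup[of q], of "(*)"]
    by (simp only: sum_product mult_single)
  then have "mpoly_eval (p * q) a = (\<Sum>m\<in>Poly_Mapping.keys p. \<Sum>m'\<in>Poly_Mapping.keys q.
      (Poly_Mapping.lookup p m * monom_eval a m) * (Poly_Mapping.lookup q m' * monom_eval a m'))"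
    by (simp add: mpoly_eval_sum mpoly_eval_single monom_eval_add mult_ac)
  then show ?thesis
    by (simp add: sum_product mpoly_eval_superset[of "Poly_Mapping.keys p" p]
        mpoly_eval_superset[of "Poly_Mapping.keys q" q])
qed

lemma mpoly_eval_const: "mpoly_eval (mpoly_const c) a = c"
  by (simp add: mpoly_const_def mpoly_eval_single monom_eval_def)

lemma mpoly_eval_var: "mpoly_eval (mpoly_var y) a = a y"
  by (simp add: mpoly_var_def mpoly_eval_single monom_eval_def)

lemma mpoly_eval_prod: "mpoly_eval (prod p A) a = (\<Prod>x\<in>A. mpoly_eval (p x) a)"
proof (induction A rule: infinite_finite_induct)
  case empty
  then show ?case
    using mpoly_eval_const[of 1 a] by (simp add: mpoly_const_def)
qed (auto simp: mpoly_eval_mult mpoly_eval_const[of 1, unfolded mpoly_const_def, simplified])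

definition node_val :: "('v, 'y) circuit \<Rightarrow> ('y \<Rightarrow> real) \<Rightarrow> 'v \<Rightarrow> real" where
  "node_val \<Phi> a u = mpoly_eval (node_poly \<Phi> u) a"

text \<open>Evaluation is a ring homomorphism, so the recursion for polynomials carries over to real
  values. The rest of the argument works with values at an arbitrary assignment.\<close>

lemma node_val_rec:
  assumes "arithmetic_circuit Y \<Phi>"
  shows "node_val \<Phi> a u =
    (case label \<Phi> u of
       Var y \<Rightarrow> a y
     | Const c \<Rightarrow> c
     | Prod \<Rightarrow> (\<Prod>v\<in>children \<Phi> u. node_val \<Phi> a v)
     | Sum \<Rightarrow> (\<Sum>v\<in>children \<Phi> u. weight \<Phi> (v, u) * node_val \<Phi> a v))"
  unfolding node_val_def
  by (subst node_poly_rec[OF assms])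
    (simp add: mpoly_eval_var mpoly_eval_const mpoly_eval_prod mpoly_eval_sum mpoly_eval_mult
      split: label.split)

lemma dep_scope_rec:
  "dep_scope \<Phi> u = {i. \<exists>j. label \<Phi> u = Var (i, j)} \<union> (\<Union>c\<in>children \<Phi> u. dep_scope \<Phi> c)"
proof -
  have "(v, u) \<in> (edges \<Phi>)\<^sup>* \<longleftrightarrow> v = u \<or> (\<exists>c\<in>children \<Phi> u. (v, c) \<in> (edges \<Phi>)\<^sup>*)" for v
    by (subst rtrancl.simps) (auto simp: children_def)
  then show ?thesis
    unfolding dep_scope_def by auto
qed

lemma dep_scope_mono: "(v, u) \<in> (edges \<Phi>)\<^sup>* \<Longrightarrow> dep_scope \<Phi> v \<subseteq> dep_scope \<Phi> u"
  unfolding dep_scope_def by (blast intro: rtrancl_trans)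

lemma arithmetic_circuit_wf:
  assumes "arithmetic_circuit Y \<Phi>"
  shows "wf (edges \<Phi>)"
proof -
  have "finite (edges \<Phi>)"
    using assms by (auto simp: arithmetic_circuit_def intro: finite_subset)
  then show ?thesis
    using assms by (simp add: arithmetic_circuit_def finite_acyclic_wf)
qed

text \<open>A path lists children before parents, so the rank grows by at least 1 along each of its
  edges.\<close>

lemma is_path_length:
  fixes rk :: "'v \<Rightarrow> nat"
  assumes "\<And>u v. (u, v) \<in> edges \<Phi> \<Longrightarrow> rk u < rk v" and "is_path \<Phi> p"
  shows "length p - 1 \<le> rk (last p)"
proof -
  have "successively (\<lambda>u v. (u, v) \<in> edges \<Phi>) p \<Longrightarrow> p \<noteq> [] \<Longrightarrow> length p \<le> Suc (rk (last p))" for p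
  proof (induction p rule: rev_induct)
    case (snoc x p)
    show ?case
    proof (cases "p = []")
      case False
      with snoc have "length p \<le> Suc (rk (last p))" "(last p, x) \<in> edges \<Phi>"
        by (auto simp: successively_append_iff)
      then show ?thesis
        using assms(1)[of "last p" x] by simp
    qed simp
  qed simp
  from this[of p] show ?thesis
    using assms(2) by (auto simp: is_path_def)
qed

lemma circuit_depth_le:
  fixes rk :: "'v \<Rightarrow> nat"
  assumes "\<And>u v. (u, v) \<in> edges \<Phi> \<Longrightarrow> rk u < rk v" and "\<And>u. u \<in> nodes \<Phi> \<Longrightarrow> rk u \<le> d"
    and "nodes \<Phi> \<noteq> {}"
  shows "circuit_depth \<Phi> \<le> d"
proof -
  define L where "L = (\<lambda>p. length p - 1) ` {p. is_path \<Phi> p}"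
  have le: "l \<le> d" if "l \<in> L" for l
  proof -
    from that obtain p where p: "is_path \<Phi> p" and l: "l = length p - 1"
      unfolding L_def by blast
    then have "last p \<in> nodes \<Phi>"
      by (auto simp: is_path_def)
    then have "rk (last p) \<le> d"
      by (rule assms(2))
    moreover have "l \<le> rk (last p)"
      unfolding l by (rule is_path_length[OF _ p]) (rule assms(1))
    ultimately show ?thesis
      by simp
  qed
  from assms(3) obtain u where "u \<in> nodes \<Phi>"
    by blast
  \<comment> \<open>\<open>Max\<close> is meaningful only on a nonempty finite set; the one-node
    path makes \<open>L\<close> nonempty.\<close>
  then have "is_path \<Phi> [u]"
    by (auto simp: is_path_def)
  then have "L \<noteq> {}"
    unfolding L_def by blast
  moreover have "finite L"
    by (rule finite_subset[of _ "{..d}"]) (use le in auto)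
  ultimately have "Max L \<le> d"
    using le by simp
  then show ?thesis
    by (simp add: circuit_depth_def L_def image_Collect)
qed

text \<open>Reduces the construction of a D&C SPN to local conditions on gates: claimed scopes
  \<open>sc\<close> and values \<open>vl\<close> that obey the defining recursions agree with the
  true ones by induction on \<open>rk\<close>, which also bounds the depth. All edges of the circuit
  get weight 1. Countability serves to encode gates as natural numbers.\<close>

lemma spn_of_gates:
  fixes N :: "'g::countable set" and ch :: "'g \<Rightarrow> 'g set" and lab :: "'g \<Rightarrow> (nat \<times> nat) label"
    and sc :: "'g \<Rightarrow> nat set" and rk :: "'g \<Rightarrow> nat"
    and vl :: "(nat \<times> nat \<Rightarrow> real) \<Rightarrow> 'g \<Rightarrow> real"
  assumes "finite N" and "r \<in> N"
    and ch: "\<And>g c. g \<in> N \<Longrightarrow> c \<in> ch g \<Longrightarrow> c \<in> N"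
    and rk: "\<And>g c. g \<in> N \<Longrightarrow> c \<in> ch g \<Longrightarrow> rk c < rk g"
    and lab: "\<And>g. g \<in> N \<Longrightarrow>
      if ch g = {} then lab g \<in> Var ` input_indices n k \<union> Const ` {0..} else lab g \<in> {Prod, Sum}"
    and sc: "\<And>g. g \<in> N \<Longrightarrow> sc g = {i. \<exists>j. lab g = Var (i, j)} \<union> (\<Union>c\<in>ch g. sc c)"
    and prod: "\<And>g. g \<in> N \<Longrightarrow> lab g = Prod \<Longrightarrow> disjoint_family_on sc (ch g)"
    and sum: "\<And>g c. g \<in> N \<Longrightarrow> lab g = Sum \<Longrightarrow> c \<in> ch g \<Longrightarrow> sc c = sc g"
    and vl: "\<And>a g. g \<in> N \<Longrightarrow> vl a g = (case lab g of
       Var y \<Rightarrow> a y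
     | Const c \<Rightarrow> c
     | Prod \<Rightarrow> (\<Prod>c\<in>ch g. vl a c)
     | Sum \<Rightarrow> (\<Sum>c\<in>ch g. vl a c))"
  shows "\<exists>\<Psi> :: (nat, nat \<times> nat) circuit. dc_spn n k \<Psi> \<and> circuit_size \<Psi> \<le> card N \<and>
    circuit_depth \<Psi> \<le> rk r \<and> (\<forall>a. mpoly_eval (circuit_poly \<Psi>) a = vl a r)"
proof -
  define S where "S = {(c, g). g \<in> N \<and> c \<in> ch g}"
  \<comment> \<open>A circuit has a unique root, so only the gates from which \<open>r\<close> can
    be reached are kept.\<close>
  define X where "X = {g. (g, r) \<in> S\<^sup>*}"
  have r: "r \<in> X"
    by (simp add: X_def)
  have X_ch: "c \<in> X" if "g \<in> X" "g \<in> N" "c \<in> ch g" for c g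
    using that unfolding X_def S_def by (blast intro: converse_rtrancl_into_rtrancl)
  have X_N: "g \<in> N" if "g \<in> X" for g
  proof -
    have "(g, r) \<in> S\<^sup>*"
      using that by (simp add: X_def)
    then show ?thesis
      by (cases rule: converse_rtranclE) (auto simp: S_def assms(2) intro: ch)
  qed
  have rk_le: "rk g \<le> rk r" if "g \<in> X" for g
  proof -
    have "(g, r) \<in> S\<^sup>*"
      using that by (simp add: X_def)
    then show ?thesis
      by (induction rule: converse_rtrancl_induct) (auto simp: S_def dest: rk)
  qed
  have X_parent: "g = r \<or> (\<exists>p\<in>X. g \<in> ch p)" if "g \<in> X" for g
  proof -
    have "(g, r) \<in> S\<^sup>*"
      using that by (simp add: X_def)
    then show ?thesis
      by (cases rule: converse_rtranclE) (auto simp: S_def X_def)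
  qed
  define \<Psi> :: "(nat, nat \<times> nat) circuit" where
    "\<Psi> = \<lparr>nodes = to_nat ` X, edges = {(to_nat c, to_nat g) | c g. g \<in> X \<and> c \<in> ch g},
           label = (\<lambda>u. lab (from_nat u)), weight = (\<lambda>_. 1)\<rparr>"
  have nodes: "nodes \<Psi> = to_nat ` X" and edges: "edges \<Psi> = {(to_nat c, to_nat g) | c g. g \<in> X \<and> c \<in> ch g}"
    and label: "label \<Psi> (to_nat g) = lab g" and weight: "weight \<Psi> e = 1" for g e
    by (simp_all add: \<Psi>_def)
  have children: "children \<Psi> (to_nat g) = to_nat ` ch g" if "g \<in> X" for g
    using that by (auto simp: children_def edges)
  have rk_edge: "rk (from_nat u) < rk (from_nat v)" if "(u, v) \<in> edges \<Psi>" for u v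
    using that by (auto simp: edges rk X_N)
  have fin: "finite X"
    using assms(1) X_N by (meson finite_subset subsetI)
  have is_root: "is_root \<Psi> u \<longleftrightarrow> u = to_nat r" for u
  proof
    assume u: "is_root \<Psi> u"
    then obtain g where g: "g \<in> X" "u = to_nat g"
      by (auto simp: is_root_def nodes)
    with X_parent[OF g(1)] u show "u = to_nat r"
      by (auto simp: is_root_def edges)
  next
    assume u: "u = to_nat r"
    \<comment> \<open>A parent of \<open>r\<close> in \<open>X\<close> would have a rank above that
      of \<open>r\<close>, which is maximal in \<open>X\<close>.\<close>
    have "r \<notin> ch g" if "g \<in> X" for g
      using rk[of g r] rk_le[OF that] X_N[OF that] by auto
    with u show "is_root \<Psi> u"
      using r by (auto simp: is_root_def nodes edges)
  qed
  have arith: "arithmetic_circuit (input_indices n k) \<Psi>"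
    unfolding arithmetic_circuit_def
  proof (intro conjI)
    show "finite (nodes \<Psi>)"
      using fin by (simp add: nodes)
    show "edges \<Psi> \<subseteq> nodes \<Psi> \<times> nodes \<Psi>"
      using X_ch X_N by (auto simp: edges nodes)
    show "acyclic (edges \<Psi>)"
    proof (rule acyclic_subset)
      show "acyclic (inv_image less_than (\<lambda>u. rk (from_nat u :: 'g)))"
        by (intro wf_acyclic wf_inv_image wf_less_than)
    qed (use rk_edge in auto)
    show "\<exists>!u. is_root \<Psi> u"
      by (simp add: is_root)
    show "\<forall>u\<in>nodes \<Psi>. if children \<Psi> u = {} then label \<Psi> u \<in> Var ` input_indices n k \<union> range Const
        else label \<Psi> u \<in> {Prod, Sum}"
    proof
      fix u assume "u \<in> nodes \<Psi>"
      then obtain g where g: "g \<in> X" "u = to_nat g"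
        by (auto simp: nodes)
      with lab[OF X_N[OF g(1)]] show "if children \<Psi> u = {} then label \<Psi> u \<in> Var ` input_indices n k \<union> range Const
        else label \<Psi> u \<in> {Prod, Sum}"
        by (auto simp: children label split: if_splits)
    qed
  qed
  have ind: "P g" if "\<And>g. g \<in> X \<Longrightarrow> (\<And>c. c \<in> ch g \<Longrightarrow> P c) \<Longrightarrow> P g" "g \<in> X" for P g
    using that(2)
  proof (induction g rule: measure_induct_rule[of rk])
    case (less g)
    then show ?case
      using that(1) rk X_N X_ch by blast
  qed
  have scope: "dep_scope \<Psi> (to_nat g) = sc g" if "g \<in> X" for g
  proof (rule ind[OF _ that])
    fix g assume "g \<in> X" "\<And>c. c \<in> ch g \<Longrightarrow> dep_scope \<Psi> (to_nat c) = sc c"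
    then show "dep_scope \<Psi> (to_nat g) = sc g"
      by (subst dep_scope_rec) (simp add: label children sc[OF X_N])
  qed
  have val: "node_val \<Psi> a (to_nat g) = vl a g" if "g \<in> X" for a g
  proof (rule ind[OF _ that])
    fix g assume "g \<in> X" "\<And>c. c \<in> ch g \<Longrightarrow> node_val \<Psi> a (to_nat c) = vl a c"
    then show "node_val \<Psi> a (to_nat g) = vl a g"
      by (subst node_val_rec[OF arith])
        (simp add: label children vl[OF X_N] sum.reindex prod.reindex weight inj_on_def
          split: label.split)
  qed
  have "monotone_circuit \<Psi>"
  proof -
    have "0 \<le> c" if "g \<in> X" "lab g = Const c" for g c
      using lab[OF X_N[OF that(1)]] that(2) by (auto split: if_splits)
    then show ?thesis
      by (auto simp: monotone_circuit_def nodes label weight)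
  qed
  moreover have "decomposable \<Psi>"
    unfolding decomposable_def
  proof (intro ballI impI)
    fix u assume "u \<in> nodes \<Psi>" "label \<Psi> u = Prod"
    then obtain g where g: "g \<in> X" "u = to_nat g" "lab g = Prod"
      by (auto simp: nodes label)
    have "disjoint_family_on sc (ch g)"
      using prod g X_N by blast
    moreover have "\<And>c. c \<in> ch g \<Longrightarrow> dep_scope \<Psi> (to_nat c) = sc c"
      using scope X_ch g(1) X_N by blast
    ultimately show "disjoint_family_on (dep_scope \<Psi>) (children \<Psi> u)"
      using g by (auto simp: children disjoint_family_on_def)
  qed
  moreover have "complete_spn \<Psi>"
    unfolding complete_spn_def
  proof (intro ballI impI)
    fix u v w assume "u \<in> nodes \<Psi>" "label \<Psi> u = Sum" and vw: "v \<in> children \<Psi> u" "w \<in> children \<Psi> u"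
    then obtain g where g: "g \<in> X" "u = to_nat g" "lab g = Sum"
      by (auto simp: nodes label)
    have "dep_scope \<Psi> (to_nat c) = sc g" if "c \<in> ch g" for c
      using scope X_ch g X_N sum that by metis
    then show "dep_scope \<Psi> v = dep_scope \<Psi> w"
      using vw g by (auto simp: children)
  qed
  ultimately have "dc_spn n k \<Psi>"
    using arith by (simp add: dc_spn_def spn_def)
  moreover have "circuit_size \<Psi> \<le> card N"
  proof -
    have "card (to_nat ` X) \<le> card X"
      by (rule card_image_le[OF fin])
    also have "\<dots> \<le> card N"
      using assms(1) X_N by (meson card_mono subsetI)
    finally show ?thesis
      by (simp add: circuit_size_def nodes)
  qed
  moreover have "circuit_depth \<Psi> \<le> rk r"
    by (rule circuit_depth_le[where rk = "\<lambda>u. rk (from_nat u)"])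
      (use rk_edge rk_le r in \<open>auto simp: nodes\<close>)
  moreover have "mpoly_eval (circuit_poly \<Psi>) a = vl a r" for a
    using val[OF r, of a] by (simp add: circuit_poly_def root_def is_root node_val_def)
  ultimately show ?thesis
    by blast
qed

subsection \<open>Cutting a circuit at a degree\<close>

locale dc_circuit =
  fixes n :: nat and k :: "nat \<Rightarrow> nat" and \<Phi> :: "('v, nat \<times> nat) circuit"
  assumes dc: "dc_spn n k \<Phi>"
begin

abbreviation below :: "'v \<Rightarrow> 'v \<Rightarrow> bool" where
  "below v u \<equiv> (v, u) \<in> (edges \<Phi>)\<^sup>*"

abbreviation scope :: "'v \<Rightarrow> nat set" where
  "scope \<equiv> dep_scope \<Phi>"

definition deg :: "'v \<Rightarrow> nat" where
  "deg u = card (scope u)"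

abbreviation val :: "(nat \<times> nat \<Rightarrow> real) \<Rightarrow> 'v \<Rightarrow> real" where
  "val \<equiv> node_val \<Phi>"

lemma arith: "arithmetic_circuit (input_indices n k) \<Phi>"
  using dc by (simp add: dc_spn_def spn_def)

lemmas wf_edges = arithmetic_circuit_wf[OF arith]
lemmas val_rec = node_val_rec[OF arith]

lemma finite_nodes: "finite (nodes \<Phi>)"
  using arith by (simp add: arithmetic_circuit_def)

lemma children_nodes: "c \<in> children \<Phi> u \<Longrightarrow> c \<in> nodes \<Phi>"
  using arith by (auto simp: arithmetic_circuit_def children_def)

lemma finite_children: "finite (children \<Phi> u)"
  using finite_nodes children_nodes by (meson finite_subset subsetI)

lemma below_nodes: "below v u \<Longrightarrow> u \<in> nodes \<Phi> \<Longrightarrow> v \<in> nodes \<Phi>"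
  by (erule converse_rtranclE) (use children_nodes in \<open>auto simp: children_def\<close>)

lemma below_iff: "below v u \<longleftrightarrow> v = u \<or> (\<exists>c\<in>children \<Phi> u. below v c)"
  by (subst rtrancl.simps) (auto simp: children_def)

lemma below_childE:
  assumes "below v u" "v \<noteq> u"
  obtains c where "c \<in> children \<Phi> u" "below v c"
  using assms below_iff[of v u] by blast

lemma below_child: "c \<in> children \<Phi> u \<Longrightarrow> below v c \<Longrightarrow> below v u"
  using below_iff[of v u] by blast

lemma not_below_child: "c \<in> children \<Phi> u \<Longrightarrow> \<not> below u c"
  using wf_acyclic[OF wf_edges] rtrancl_into_trancl1[of u c "edges \<Phi>" u]
  unfolding children_def acyclic_def by blast

lemma circuit_induct [case_names node]:
  assumes "\<And>u. (\<And>c. c \<in> children \<Phi> u \<Longrightarrow> P c) \<Longrightarrow> P u"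
  shows "P u"
  using wf_edges by (rule wf_induct_rule) (use assms in \<open>auto simp: children_def\<close>)

lemma node_cases [consumes 1, case_names Var Const Prod Sum]:
  assumes "u \<in> nodes \<Phi>"
  obtains i j where "label \<Phi> u = Var (i, j)" "(i, j) \<in> input_indices n k" "children \<Phi> u = {}"
  | c where "label \<Phi> u = Const c" "children \<Phi> u = {}"
  | "label \<Phi> u = Prod" "children \<Phi> u \<noteq> {}"
  | "label \<Phi> u = Sum" "children \<Phi> u \<noteq> {}"
proof -
  have "if children \<Phi> u = {} then label \<Phi> u \<in> Var ` input_indices n k \<union> range Const
      else label \<Phi> u \<in> {Prod, Sum}"
    using arith assms unfolding arithmetic_circuit_def by blast
  then show thesis
    using that by (cases "children \<Phi> u = {}") auto
qed

section \<open>Scopes and degrees of nodes\<close>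

lemma scope_subset: "u \<in> nodes \<Phi> \<Longrightarrow> scope u \<subseteq> {1..n}"
proof
  fix i assume "u \<in> nodes \<Phi>" "i \<in> scope u"
  then obtain v j where "v \<in> nodes \<Phi>" "label \<Phi> v = Var (i, j)"
    using below_nodes by (auto simp: dep_scope_def)
  then show "i \<in> {1..n}"
    by (cases rule: node_cases) (auto simp: input_indices_def)
qed

lemma finite_scope: "u \<in> nodes \<Phi> \<Longrightarrow> finite (scope u)"
  using scope_subset finite_subset by blast

lemma deg_le: "u \<in> nodes \<Phi> \<Longrightarrow> deg u \<le> n"
  using card_mono[OF _ scope_subset, of u] by (simp add: deg_def)

lemma deg_0_iff: "u \<in> nodes \<Phi> \<Longrightarrow> deg u = 0 \<longleftrightarrow> scope u = {}"
  by (simp add: deg_def finite_scope)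

lemma deg_mono: "below v u \<Longrightarrow> u \<in> nodes \<Phi> \<Longrightarrow> deg v \<le> deg u"
  unfolding deg_def by (intro card_mono finite_scope dep_scope_mono)

lemma deg_diff: "below v u \<Longrightarrow> u \<in> nodes \<Phi> \<Longrightarrow> card (scope u - scope v) = deg u - deg v"
  unfolding deg_def by (intro card_Diff_subset dep_scope_mono) (auto intro: finite_scope below_nodes)

lemma scope_child: "c \<in> children \<Phi> u \<Longrightarrow> scope c \<subseteq> scope u"
  by (rule dep_scope_mono[OF below_child[OF _ rtrancl_refl]])

lemma scope_Const:
  assumes "u \<in> nodes \<Phi>" "label \<Phi> u = Const c"
  shows "scope u = {}"
  using assms(1) by (cases rule: node_cases; subst dep_scope_rec) (use assms(2) in auto)

lemma scope_Prod: "label \<Phi> u = Prod \<Longrightarrow> scope u = (\<Union>c\<in>children \<Phi> u. scope c)"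
  by (subst dep_scope_rec) simp

lemma scope_Sum:
  assumes "u \<in> nodes \<Phi>" "label \<Phi> u = Sum" "c \<in> children \<Phi> u"
  shows "scope c = scope u"
proof -
  have "scope c' = scope c" if "c' \<in> children \<Phi> u" for c'
    using dc assms that unfolding dc_spn_def complete_spn_def by blast
  then have "(\<Union>c'\<in>children \<Phi> u. scope c') = scope c"
    using assms(3) by blast
  then show ?thesis
    using assms(2) by (subst (2) dep_scope_rec) simp
qed

lemma scope_disjoint:
  assumes "u \<in> nodes \<Phi>" "label \<Phi> u = Prod" "c \<in> children \<Phi> u" "c' \<in> children \<Phi> u" "c \<noteq> c'"
  shows "scope c \<inter> scope c' = {}"
  using dc assms unfolding dc_spn_def decomposable_def disjoint_family_on_def by blast

text \<open>Children of a product node share no variable, so their degrees add up. This is what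
  makes a child with more than half of the degree unique.\<close>

lemma deg_disjoint:
  assumes "u \<in> nodes \<Phi>" "label \<Phi> u = Prod" "c \<in> children \<Phi> u" "c' \<in> children \<Phi> u" "c \<noteq> c'"
  shows "deg c + deg c' \<le> deg u"
proof -
  have "deg c + deg c' = card (scope c \<union> scope c')"
    unfolding deg_def using assms scope_disjoint[OF assms] children_nodes
    by (simp add: card_Un_disjoint finite_scope)
  also have "\<dots> \<le> deg u"
    unfolding deg_def using assms by (intro card_mono finite_scope) (auto simp: scope_Prod)
  finally show ?thesis .
qed

section \<open>Quotients of nodes as partial derivatives\<close>

text \<open>The body of the recursion, kept separate for \<open>wfrec\<close>. In the product case
  every child above \<open>v\<close> is replaced by its quotient, which avoids choosing one of them;
  the guard yields 0 instead of the plain product of values when no child lies above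
  \<open>v\<close>.\<close>

definition quot_step ::
  "(nat \<times> nat \<Rightarrow> real) \<Rightarrow> 'v \<Rightarrow> ('v \<Rightarrow> real) \<Rightarrow> 'v \<Rightarrow> real" where
  "quot_step a v q u = (if u = v then 1 else
     case label \<Phi> u of
       Prod \<Rightarrow> if \<exists>c\<in>children \<Phi> u. below v c
         then \<Prod>c\<in>children \<Phi> u. if below v c then q c else val a c else 0
     | Sum \<Rightarrow> (\<Sum>c\<in>children \<Phi> u. weight \<Phi> (c, u) * q c)
     | _ \<Rightarrow> 0)"

text \<open>\<open>quot a u v\<close> is the partial derivative of \<open>u\<close> with respect to \<open>v\<close>, evaluated at \<open>a\<close>, whenever
  \<open>scope v\<close> is nonempty: then at most one child of a product node lies above \<open>v\<close>.\<close>

definition quot :: "(nat \<times> nat \<Rightarrow> real) \<Rightarrow> 'v \<Rightarrow> 'v \<Rightarrow> real" where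
  "quot a u v = wfrec (edges \<Phi>) (quot_step a v) u"

lemma quot_rec: "quot a u v = quot_step a v (\<lambda>c. quot a c v) u"
proof -
  \<comment> \<open>The body reads \<open>q\<close> only at children of \<open>u\<close>, so the cut
    made by \<open>wfrec\<close> is harmless.\<close>
  have cong: "quot_step a v q u = quot_step a v q' u"
    if "\<And>c. c \<in> children \<Phi> u \<Longrightarrow> q c = q' c" for q q'
    unfolding quot_step_def using that
    by (intro if_cong refl label.case_cong prod.cong sum.cong arg_cong2[of _ _ _ _ "(*)"]) auto
  show ?thesis
    unfolding quot_def by (subst wfrec[OF wf_edges], rule cong) (simp add: children_def cut_apply)
qed

lemma quot_self [simp]: "quot a u u = 1"
  by (subst quot_rec, unfold quot_step_def) simp

lemma quot_Sum:
  "label \<Phi> u = Sum \<Longrightarrow> u \<noteq> v \<Longrightarrow> quot a u v = (\<Sum>c\<in>children \<Phi> u. weight \<Phi> (c, u) * quot a c v)"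
  by (subst quot_rec, unfold quot_step_def) simp

lemma quot_not_below: "\<not> below v u \<Longrightarrow> quot a u v = 0"
proof (induction u rule: circuit_induct)
  case (node u)
  then have "\<not> below v c" if "c \<in> children \<Phi> u" for c
    using that below_child by blast
  moreover have "u \<noteq> v"
    using node.prems by blast
  ultimately show ?case
    using node.IH by (subst quot_rec, unfold quot_step_def) (simp split: label.split)
qed

lemma quot_nonzero: "quot a u v \<noteq> 0 \<Longrightarrow> below v u"
  using quot_not_below by blast

text \<open>Different children have disjoint scopes, which cannot both contain the nonempty scope of
  \<open>v\<close>.\<close>

lemma below_child_unique:
  assumes "u \<in> nodes \<Phi>" "label \<Phi> u = Prod" "c \<in> children \<Phi> u" "c' \<in> children \<Phi> u"
    and "below v c" "below v c'" "0 < deg v"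
  shows "c = c'"
proof (rule ccontr)
  assume "c \<noteq> c'"
  with assms have "scope c \<inter> scope c' = {}"
    by (intro scope_disjoint)
  then have "scope v = {}"
    using dep_scope_mono[OF assms(5)] dep_scope_mono[OF assms(6)] by blast
  with assms(7) show False
    by (simp add: deg_def)
qed

text \<open>The Leibniz rule with a single surviving term, because \<open>c\<close> is the only
  child above \<open>v\<close>.\<close>

lemma quot_Prod:
  assumes "u \<in> nodes \<Phi>" "label \<Phi> u = Prod" "c \<in> children \<Phi> u" "below v c" "0 < deg v"
  shows "quot a u v = quot a c v * (\<Prod>c'\<in>children \<Phi> u - {c}. val a c')"
proof -
  have ne: "u \<noteq> v"
    using not_below_child assms(3,4) by blast
  have "quot a u v = (\<Prod>c'\<in>children \<Phi> u. if below v c' then quot a c' v else val a c')"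
    using assms ne by (subst quot_rec, unfold quot_step_def) auto
  also have "\<dots> = quot a c v * (\<Prod>c'\<in>children \<Phi> u - {c}. if below v c' then quot a c' v else val a c')"
    using assms by (subst prod.remove[OF finite_children assms(3)]) simp
  also have "(\<Prod>c'\<in>children \<Phi> u - {c}. if below v c' then quot a c' v else val a c')
      = (\<Prod>c'\<in>children \<Phi> u - {c}. val a c')"
    using below_child_unique[OF assms(1-3) _ assms(4) _ assms(5)] by (intro prod.cong) auto
  finally show ?thesis .
qed

text \<open>No variable leaf lies below \<open>u\<close>. This allows gates of degree 0 to be
  labeled by constants.\<close>

lemma val_cong: "u \<in> nodes \<Phi> \<Longrightarrow> scope u = {} \<Longrightarrow> val a u = val b u"
proof (induction u rule: circuit_induct)
  case (node u)
  have IH: "val a c = val b c" if "c \<in> children \<Phi> u" for c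
    using node.IH[OF that children_nodes[OF that]] node.prems(2) scope_child[OF that] by auto
  have "label \<Phi> u \<noteq> Var y" for y
    using node.prems(2) by (cases y) (subst (asm) dep_scope_rec, auto)
  with IH show ?case
    unfolding val_rec[of a u] val_rec[of b u] by (simp split: label.split)
qed

text \<open>A quotient involves only variables in \<open>scope u - scope v\<close>, here none. This
  allows quotients of nodes of equal degree to be labeled by constants.\<close>

lemma quot_cong: "u \<in> nodes \<Phi> \<Longrightarrow> scope u \<subseteq> scope v \<Longrightarrow> 0 < deg v \<Longrightarrow> quot a u v = quot b u v"
proof (induction u rule: circuit_induct)
  case (node u)
  have IH: "quot a c v = quot b c v" if "c \<in> children \<Phi> u" for c
    using node.IH[OF that children_nodes[OF that] subset_trans[OF scope_child[OF that] node.prems(2)]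
        node.prems(3)] .
  consider "u = v" | "\<not> below v u" | "u \<noteq> v" "below v u"
    by blast
  then show ?case
  proof cases
    case 3
    from node.prems(1) show ?thesis
    proof (cases rule: node_cases)
      case Prod
      obtain c where c: "c \<in> children \<Phi> u" "below v c"
        using 3 below_childE by metis
      \<comment> \<open>The scope of a sibling of \<open>c\<close> is disjoint from
        \<open>scope c\<close>, which contains \<open>scope v\<close> and hence all of
        \<open>scope u\<close>; it is therefore empty.\<close>
      have "val a c' = val b c'" if "c' \<in> children \<Phi> u - {c}" for c'
      proof (rule val_cong)
        have "scope c' \<inter> scope c = {}"
          using scope_disjoint[OF node.prems(1) Prod(1)] that c by blast
        moreover have "scope c' \<subseteq> scope v"
          using that node.prems(2) scope_child[of c' u] by blast
        ultimately show "scope c' = {}"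
          using dep_scope_mono[OF c(2)] by blast
      qed (use that children_nodes in blast)
      then show ?thesis
        using quot_Prod[OF node.prems(1) Prod(1) c node.prems(3)] IH[OF c(1)] by simp
    next
      case Sum
      then show ?thesis
        using 3 IH by (simp add: quot_Sum)
    qed (use 3 below_iff[of v u] in simp_all)
  qed (simp_all add: quot_not_below)
qed

lemma weight_nonneg: "u \<in> nodes \<Phi> \<Longrightarrow> label \<Phi> u = Sum \<Longrightarrow> c \<in> children \<Phi> u \<Longrightarrow> 0 \<le> weight \<Phi> (c, u)"
  using dc unfolding dc_spn_def spn_def monotone_circuit_def by blast

lemma Const_nonneg: "u \<in> nodes \<Phi> \<Longrightarrow> label \<Phi> u = Const c \<Longrightarrow> 0 \<le> c"
  using dc unfolding dc_spn_def spn_def monotone_circuit_def by blast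

text \<open>At the zero assignment, this and its analogue for \<open>quot\<close> make the constants
  of the new gates admissible in a monotone circuit.\<close>

lemma val_nonneg:
  assumes "\<And>y. 0 \<le> a y"
  shows "u \<in> nodes \<Phi> \<Longrightarrow> 0 \<le> val a u"
proof (induction u rule: circuit_induct)
  case (node u)
  have IH: "0 \<le> val a c" if "c \<in> children \<Phi> u" for c
    using node.IH[OF that children_nodes[OF that]] .
  have "0 \<le> weight \<Phi> (c, u) * val a c" if "label \<Phi> u = Sum" "c \<in> children \<Phi> u" for c
    using weight_nonneg[OF node.prems that] IH[OF that(2)] by simp
  then show ?case
    using assms IH Const_nonneg[OF node.prems]
    by (subst val_rec) (simp add: prod_nonneg sum_nonneg split: label.split)
qed

lemma quot_nonneg:
  assumes "\<And>y. 0 \<le> a y"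
  shows "u \<in> nodes \<Phi> \<Longrightarrow> 0 \<le> quot a u v"
proof (induction u rule: circuit_induct)
  case (node u)
  have IH: "0 \<le> quot a c v" "0 \<le> val a c" if "c \<in> children \<Phi> u" for c
    using node.IH[OF that children_nodes[OF that]] val_nonneg[OF assms children_nodes[OF that]] .
  have "0 \<le> weight \<Phi> (c, u) * quot a c v" if "label \<Phi> u = Sum" "c \<in> children \<Phi> u" for c
    using weight_nonneg[OF node.prems that] IH(1)[OF that(2)] by simp
  then show ?case
    using IH by (subst quot_rec, unfold quot_step_def) (simp add: prod_nonneg sum_nonneg split: label.split)
qed

section \<open>The frontier of a degree and expansions along it\<close>

text \<open>Children of a sum node have the degree of that node, and constants have degree 0, so a
  descent can leave the degrees above \<open>m\<close> only at the two kinds of nodes listed. A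
  variable leaf has degree 1 and occurs only for \<open>m = 0\<close>.\<close>

definition frontier :: "nat \<Rightarrow> 'v set" where
  "frontier m = {w \<in> nodes \<Phi>. (label \<Phi> w = Prod \<or> label \<Phi> w \<in> range Var) \<and> m < deg w \<and>
     (\<forall>c\<in>children \<Phi> w. deg c \<le> m)}"

lemma finite_frontier: "finite (frontier m)"
  using finite_nodes by (simp add: frontier_def)

text \<open>One step of a descent that keeps the degree above \<open>m\<close>: off the frontier it
  can always continue.\<close>

lemma not_frontier_cases [consumes 3, case_names Prod Sum]:
  assumes "u \<in> nodes \<Phi>" "m < deg u" "u \<notin> frontier m"
  obtains c where "label \<Phi> u = Prod" "c \<in> children \<Phi> u" "m < deg c"
  | "label \<Phi> u = Sum" "children \<Phi> u \<noteq> {}" "\<And>c. c \<in> children \<Phi> u \<Longrightarrow> deg c = deg u"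
  using assms(1)
proof (cases rule: node_cases)
  case (Const c)
  then show ?thesis
    using assms scope_Const[of u c] by (simp add: deg_def)
next
  case Sum
  then show ?thesis
    using assms(1) scope_Sum[of u] that(2) by (simp add: deg_def)
qed (use assms that(1) in \<open>auto simp: frontier_def not_le\<close>)

lemma below_frontier_exists:
  "u \<in> nodes \<Phi> \<Longrightarrow> m < deg u \<Longrightarrow> \<exists>w\<in>frontier m. below w u"
proof (induction u rule: circuit_induct)
  case (node u)
  show ?case
  proof (cases "u \<in> frontier m")
    case False
    with node.prems obtain c where "c \<in> children \<Phi> u" "m < deg c"
      by (cases rule: not_frontier_cases) (metis all_not_in_conv node.prems(2))+
    with node.IH show ?thesis
      using children_nodes below_child by blast
  qed blast
qed

text \<open>The descent goes towards \<open>v\<close> and stops at the last node of degree above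
  \<open>m\<close> on its way. That node is on the frontier: otherwise it would have another child
  of degree above \<open>m\<close>, which together with the child above \<open>v\<close> has degree
  at least \<open>2 * deg v\<close>, more than \<open>deg u\<close>.\<close>

lemma between_frontier_exists:
  "u \<in> nodes \<Phi> \<Longrightarrow> below v u \<Longrightarrow> deg v \<le> m \<Longrightarrow> m < deg u \<Longrightarrow> deg u < 2 * deg v \<Longrightarrow>
    \<exists>w\<in>frontier m. below v w \<and> below w u"
proof (induction u rule: circuit_induct)
  case (node u)
  have "u \<noteq> v"
    using node.prems by auto
  then obtain c where c: "c \<in> children \<Phi> u" "below v c"
    using node.prems(2) below_childE by metis
  have cn: "c \<in> nodes \<Phi>"
    using c(1) by (rule children_nodes)
  show ?case
  proof (cases "m < deg c")
    case True
    have "deg c \<le> deg u"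
      using c(1) node.prems(1) below_child deg_mono by blast
    then have "\<exists>w\<in>frontier m. below v w \<and> below w c"
      using node c cn True by simp
    then show ?thesis
      using c(1) below_child by blast
  next
    case False
    have "u \<in> frontier m"
    proof (rule ccontr)
      assume "u \<notin> frontier m"
      from node.prems(1,4) this show False
      proof (cases rule: not_frontier_cases)
        case (Prod c')
        then have "deg c' + deg c \<le> deg u"
          using False c(1) node.prems(1) by (intro deg_disjoint) auto
        moreover have "deg v \<le> deg c"
          using c(2) cn by (rule deg_mono)
        ultimately show False
          using Prod(3) node.prems by linarith
      next
        case Sum
        then show False
          using False c(1) node.prems(4) by simp
      qed
    qed
    then show ?thesis
      using node.prems(2) by blast
  qed
qed

text \<open>Every monomial of a node of degree above \<open>m\<close> is built along a unique path that descends to the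
  heaviest child and crosses degree \<open>m\<close> at one frontier node; \<open>D < 2 * (m + 1)\<close> makes the heavy child
  unique. \<open>F\<close> is instantiated with \<open>val\<close> and with \<open>\<lambda>u. quot a u v\<close>.\<close>

lemma frontier_expansion:
  assumes Sum: "\<And>u. u \<in> nodes \<Phi> \<Longrightarrow> m < deg u \<Longrightarrow> label \<Phi> u = Sum \<Longrightarrow>
      F u = (\<Sum>c\<in>children \<Phi> u. weight \<Phi> (c, u) * F c)"
    and Prod: "\<And>u c. u \<in> nodes \<Phi> \<Longrightarrow> deg u \<le> D \<Longrightarrow> label \<Phi> u = Prod \<Longrightarrow> c \<in> children \<Phi> u \<Longrightarrow>
      m < deg c \<Longrightarrow> F u = F c * (\<Prod>c'\<in>children \<Phi> u - {c}. val a c')"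
    and D: "D < 2 * (m + 1)"
  shows "u \<in> nodes \<Phi> \<Longrightarrow> m < deg u \<Longrightarrow> deg u \<le> D \<Longrightarrow> F u = (\<Sum>w\<in>frontier m. quot a u w * F w)"
proof (induction u rule: circuit_induct)
  case (node u)
  show ?case
  proof (cases "u \<in> frontier m")
    case True
    \<comment> \<open>Frontier nodes form an antichain, since everything strictly below one has
      degree at most \<open>m\<close>. Only the term \<open>w = u\<close> survives.\<close>
    have "quot a u w = 0" if w: "w \<in> frontier m" "w \<noteq> u" for w
    proof (rule quot_not_below, rule)
      assume "below w u"
      then obtain c where "c \<in> children \<Phi> u" "below w c"
        using w(2) by (rule below_childE)
      then have "deg w \<le> deg c" "deg c \<le> m"
        using True children_nodes by (auto simp: frontier_def intro: deg_mono)
      with w(1) show False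
        by (simp add: frontier_def)
    qed
    then have "(\<Sum>w\<in>frontier m. quot a u w * F w) = (\<Sum>w\<in>{u}. quot a u w * F w)"
      using True by (intro sum.mono_neutral_right finite_frontier) auto
    then show ?thesis
      by simp
  next
    case False
    from node.prems(1,2) False show ?thesis
    proof (cases rule: not_frontier_cases)
      case P: (Prod c)
      have IH: "F c = (\<Sum>w\<in>frontier m. quot a c w * F w)"
      proof (rule node.IH)
        show "deg c \<le> D"
          using below_child[OF P(2)] deg_mono[of c u] node.prems by fastforce
      qed (use P children_nodes in auto)
      \<comment> \<open>For \<open>w\<close> not below \<open>c\<close> both sides vanish: a
        different child above \<open>w\<close> would also have degree above \<open>m\<close>, and
        the two together would exceed \<open>D\<close>.\<close>
      have "quot a u w = quot a c w * (\<Prod>c'\<in>children \<Phi> u - {c}. val a c')" if w: "w \<in> frontier m" for w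
      proof (cases "below w c")
        case True
        then show ?thesis
          using w P node.prems by (intro quot_Prod) (auto simp: frontier_def)
      next
        case nb: False
        have "\<not> below w u"
        proof
          assume "below w u"
          moreover have "w \<noteq> u"
            using w False by blast
          ultimately obtain c' where c': "c' \<in> children \<Phi> u" "below w c'"
            by (rule below_childE)
          with nb have "deg c' + deg c \<le> deg u"
            using node.prems P by (intro deg_disjoint) auto
          moreover have "m < deg c'"
            using deg_mono[OF c'(2) children_nodes[OF c'(1)]] w by (simp add: frontier_def)
          ultimately show False
            using P(3) D node.prems by simp
        qed
        then show ?thesis
          using nb by (simp add: quot_not_below)
      qed
      then show ?thesis
        using Prod[OF node.prems(1,3) P] IH by (simp add: sum_distrib_left sum_distrib_right mult_ac)
    next
      case S: Sum
      have "F u = (\<Sum>c\<in>children \<Phi> u. weight \<Phi> (c, u) * F c)"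
        using node.prems S by (intro Sum)
      also have "\<dots> = (\<Sum>c\<in>children \<Phi> u. \<Sum>w\<in>frontier m. weight \<Phi> (c, u) * quot a c w * F w)"
        using node S children_nodes by (intro sum.cong) (auto simp: sum_distrib_left mult_ac)
      also have "\<dots> = (\<Sum>w\<in>frontier m. (\<Sum>c\<in>children \<Phi> u. weight \<Phi> (c, u) * quot a c w) * F w)"
        by (subst sum.swap) (simp add: sum_distrib_right)
      also have "\<dots> = (\<Sum>w\<in>frontier m. quot a u w * F w)"
        using False S(1) by (intro sum.cong refl arg_cong2[of _ _ _ _ "(*)"] quot_Sum[symmetric]) auto
      finally show ?thesis .
    qed
  qed
qed

text \<open>The instance \<open>F = val a\<close>, \<open>D = deg u\<close> of
  \<open>frontier_expansion\<close>. Quotients by nodes not below \<open>u\<close> vanish; dropping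
  them leaves the index set used for the children of a \<open>Val\<close> gate.\<close>

lemma val_expansion:
  assumes "u \<in> nodes \<Phi>" "m < deg u" "deg u < 2 * (m + 1)"
  shows "val a u = (\<Sum>w | w \<in> frontier m \<and> below w u. quot a u w * val a w)"
proof -
  have "val a u = (\<Sum>w\<in>frontier m. quot a u w * val a w)"
  proof (rule frontier_expansion[OF _ _ assms(3) assms(1,2)])
    show "val a u = val a c * (\<Prod>c'\<in>children \<Phi> u - {c}. val a c')"
      if "label \<Phi> u = Prod" "c \<in> children \<Phi> u" for u c
      using that by (subst val_rec) (simp add: prod.remove[OF finite_children, of c u])
    show "val a u = (\<Sum>c\<in>children \<Phi> u. weight \<Phi> (c, u) * val a c)" if "label \<Phi> u = Sum" for u
      using that by (subst val_rec) simp
  qed simp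
  also have "\<dots> = (\<Sum>w | w \<in> frontier m \<and> below w u. quot a u w * val a w)"
    by (rule sum.mono_neutral_right) (auto simp: finite_frontier quot_not_below)
  finally show ?thesis .
qed

text \<open>The instance \<open>F u = quot a u v\<close>, \<open>D = deg u\<close>. The bound
  \<open>D < 2 * (m + 1)\<close> follows from \<open>deg u < 2 * deg v\<close> and
  \<open>deg v \<le> m\<close>.\<close>

lemma quot_expansion:
  assumes "u \<in> nodes \<Phi>" "deg v \<le> m" "m < deg u" "deg u < 2 * deg v"
  shows "quot a u v = (\<Sum>w | w \<in> frontier m \<and> below v w \<and> below w u. quot a u w * quot a w v)"
proof -
  have "quot a u v = (\<Sum>w\<in>frontier m. quot a u w * quot a w v)"
  proof (rule frontier_expansion[OF _ _ _ assms(1,3)])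
    show "quot a u' v = (\<Sum>c\<in>children \<Phi> u'. weight \<Phi> (c, u') * quot a c v)"
      if "label \<Phi> u' = Sum" "m < deg u'" for u'
      using that assms(2) by (intro quot_Sum) auto
    show "quot a u' v = quot a c v * (\<Prod>c'\<in>children \<Phi> u' - {c}. val a c')"
      if P: "u' \<in> nodes \<Phi>" "deg u' \<le> deg u" "label \<Phi> u' = Prod" "c \<in> children \<Phi> u'" "m < deg c" for u' c
    proof (cases "below v c")
      case True
      with P assms show ?thesis
        by (intro quot_Prod) auto
    next
      case False
      \<comment> \<open>Both sides are 0: a second child above \<open>v\<close> would, together with
        \<open>c\<close>, have degree at least \<open>2 * deg v\<close>, more than
        \<open>deg u\<close>.\<close>
      have "\<not> below v u'"
      proof
        assume "below v u'"
        moreover have "v \<noteq> u'"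
          using P assms(2) deg_mono[of c u'] below_child[of c u' c] by fastforce
        ultimately obtain c' where c': "c' \<in> children \<Phi> u'" "below v c'"
          by (rule below_childE)
        with False have "deg c' + deg c \<le> deg u'"
          using P by (intro deg_disjoint) auto
        moreover have "deg v \<le> deg c'"
          using c' children_nodes deg_mono by blast
        ultimately show False
          using P assms by linarith
      qed
      then show ?thesis
        using False by (simp add: quot_not_below)
    qed
  qed (use assms in auto)
  also have "\<dots> = (\<Sum>w | w \<in> frontier m \<and> below v w \<and> below w u. quot a u w * quot a w v)"
    by (rule sum.mono_neutral_right) (auto simp: finite_frontier dest: quot_nonzero)
  finally show ?thesis .
qed

end

subsection \<open>The balanced circuit\<close>

text \<open>\<open>Val\<close> and \<open>Quot\<close> are the quantities to compute,
  \<open>ValTerm\<close> and \<open>QuotTerm\<close> the summands of their expansions.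
  \<open>Leaf w\<close> is the input itself, distinct from \<open>Val w\<close>, which becomes a sum
  gate whenever its degree is positive.\<close>

datatype 'v gate = Val 'v | Leaf 'v | ValTerm 'v 'v | Quot 'v 'v | QuotTerm 'v 'v 'v

instance gate :: (countable) countable
  by countable_datatype

context dc_circuit
begin

text \<open>The condition \<open>deg u < 2 * deg v\<close> is inherited by all quotients in the frontier expansions
  and is what makes them applicable.\<close>

fun gate_ok :: "'v gate \<Rightarrow> bool" where
  "gate_ok (Val u) \<longleftrightarrow> u \<in> nodes \<Phi>"
| "gate_ok (Leaf w) \<longleftrightarrow> w \<in> nodes \<Phi> \<and> label \<Phi> w \<in> range Var"
| "gate_ok (ValTerm u w) \<longleftrightarrow> u \<in> nodes \<Phi> \<and> w \<in> frontier (deg u div 2) \<and> below w u"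
| "gate_ok (Quot u v) \<longleftrightarrow> u \<in> nodes \<Phi> \<and> below v u \<and> deg u < 2 * deg v"
| "gate_ok (QuotTerm u w v) \<longleftrightarrow> u \<in> nodes \<Phi> \<and> deg v < deg u \<and> deg u < 2 * deg v \<and>
     w \<in> frontier ((deg u + deg v) div 2) \<and> below v w \<and> below w u"

text \<open>The cuts are at half the degree and at the midpoint of both degrees. A frontier node
  \<open>w\<close> may still have the full degree of \<open>u\<close>, so a product node
  \<open>w\<close> is opened at once and its children, of degree at most the cut, become factors of
  the term.\<close>

fun gate_children :: "'v gate \<Rightarrow> 'v gate set" where
  "gate_children (Val u) =
     (if deg u = 0 then {} else ValTerm u ` {w \<in> frontier (deg u div 2). below w u})"
| "gate_children (Leaf w) = {}"
| "gate_children (ValTerm u w) =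
     insert (Quot u w) (if label \<Phi> w = Prod then Val ` children \<Phi> w else {Leaf w})"
| "gate_children (Quot u v) = (if deg u = deg v then {} else
     (\<lambda>w. QuotTerm u w v) ` {w \<in> frontier ((deg u + deg v) div 2). below v w \<and> below w u})"
| "gate_children (QuotTerm u w v) =
     insert (Quot u w) ((\<lambda>c. if below v c then Quot c v else Val c) ` children \<Phi> w)"

text \<open>Gates of degree 0 do not depend on the assignment, so their value at 0 is the constant.\<close>

fun gate_label :: "'v gate \<Rightarrow> (nat \<times> nat) label" where
  "gate_label (Val u) = (if deg u = 0 then Const (val (\<lambda>_. 0) u) else Sum)"
| "gate_label (Leaf w) = label \<Phi> w"
| "gate_label (ValTerm u w) = Prod"
| "gate_label (Quot u v) = (if deg u = deg v then Const (quot (\<lambda>_. 0) u v) else Sum)"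
| "gate_label (QuotTerm u w v) = Prod"

text \<open>By set-multilinearity, a derivative with respect to \<open>v\<close> is free of the
  variables of \<open>v\<close>.\<close>

fun gate_scope :: "'v gate \<Rightarrow> nat set" where
  "gate_scope (Val u) = scope u"
| "gate_scope (Leaf w) = scope w"
| "gate_scope (ValTerm u w) = scope u"
| "gate_scope (Quot u v) = scope u - scope v"
| "gate_scope (QuotTerm u w v) = scope u - scope v"

fun gate_val :: "(nat \<times> nat \<Rightarrow> real) \<Rightarrow> 'v gate \<Rightarrow> real" where
  "gate_val a (Val u) = val a u"
| "gate_val a (Leaf w) = val a w"
| "gate_val a (ValTerm u w) = quot a u w * val a w"
| "gate_val a (Quot u v) = quot a u v"
| "gate_val a (QuotTerm u w v) = quot a u w * quot a w v"

text \<open>\<open>floorlog 2 d\<close> is the bit length of \<open>d\<close>, which drops by 1 when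
  a positive \<open>d\<close> is halved. The offsets 2, 1, 0, -1 order \<open>Quot\<close>,
  \<open>QuotTerm\<close>, \<open>Val\<close>, \<open>ValTerm\<close> within one bit length, hence
  the factor 4.\<close>

fun gate_rank :: "'v gate \<Rightarrow> nat" where
  "gate_rank (Val u) = 4 * floorlog 2 (deg u)"
| "gate_rank (Leaf w) = 0"
| "gate_rank (ValTerm u w) = 4 * floorlog 2 (deg u) - 1"
| "gate_rank (Quot u v) = 4 * floorlog 2 (deg u - deg v) + 2"
| "gate_rank (QuotTerm u w v) = 4 * floorlog 2 (deg u - deg v) + 1"

section \<open>Local conditions on the gates\<close>

lemma floorlog_half: "0 < d \<Longrightarrow> floorlog 2 d = Suc (floorlog 2 (d div 2))"
  by (subst compute_floorlog) simp

lemma floorlog_half_less: "0 < d \<Longrightarrow> e \<le> d div 2 \<Longrightarrow> floorlog 2 e < floorlog 2 d"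
  using floorlog_mono[of e "d div 2" 2] by (simp add: floorlog_half[of d])

lemma frontier_nodes: "w \<in> frontier m \<Longrightarrow> w \<in> nodes \<Phi>"
  and frontier_deg: "w \<in> frontier m \<Longrightarrow> m < deg w"
  and frontier_children: "w \<in> frontier m \<Longrightarrow> c \<in> children \<Phi> w \<Longrightarrow> deg c \<le> m"
  by (simp_all add: frontier_def)

lemma frontier_cases:
  assumes "w \<in> frontier m"
  obtains "label \<Phi> w = Prod" "children \<Phi> w \<noteq> {}"
  | "label \<Phi> w \<in> range Var" "children \<Phi> w = {}" "label \<Phi> w \<noteq> Prod"
  using frontier_nodes[OF assms]
  by (cases rule: node_cases) (use assms that in \<open>auto simp: frontier_def\<close>)

text \<open>The degree of \<open>w\<close> exceeds that of \<open>v\<close>, so \<open>w\<close>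
  lies strictly above \<open>v\<close> and has a child; on the frontier only product nodes have
  children.\<close>

lemma QuotTerm_Prod:
  assumes "gate_ok (QuotTerm u w v)"
  obtains c where "label \<Phi> w = Prod" "c \<in> children \<Phi> w" "below v c"
proof -
  have w: "w \<in> frontier ((deg u + deg v) div 2)" "below v w"
    using assms by simp_all
  have "deg v < deg u"
    using assms by simp
  with frontier_deg[OF w(1)] have "deg v < deg w"
    by linarith
  then have "v \<noteq> w"
    by auto
  with w(2) obtain c where c: "c \<in> children \<Phi> w" "below v c"
    by (rule below_childE)
  from w(1) have "label \<Phi> w = Prod"
    by (cases rule: frontier_cases) (use c in auto)
  with c that show thesis
    by blast
qed

text \<open>The invariant \<open>deg u < 2 * deg v\<close> passes on: a frontier node
  \<open>w\<close> has degree above the cut, giving \<open>deg u < 2 * deg w\<close>, and the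
  children of \<open>w\<close> in a \<open>QuotTerm\<close> have degree at most the midpoint, below
  \<open>2 * deg v\<close>.\<close>

lemma gate_ok_child: "gate_ok g \<Longrightarrow> h \<in> gate_children g \<Longrightarrow> gate_ok h"
proof (cases g)
  case (ValTerm u w)
  assume "gate_ok g" "h \<in> gate_children g"
  with ValTerm have ok: "u \<in> nodes \<Phi>" "w \<in> frontier (deg u div 2)" "below w u"
    and h: "h = Quot u w \<or> (label \<Phi> w = Prod \<and> h \<in> Val ` children \<Phi> w) \<or> (label \<Phi> w \<noteq> Prod \<and> h = Leaf w)"
    by (auto split: if_splits)
  have "deg u < 2 * deg w"
    using frontier_deg[OF ok(2)] by simp
  moreover have "label \<Phi> w \<in> range Var" if "label \<Phi> w \<noteq> Prod"
    using ok(2) that by (simp add: frontier_def)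
  ultimately show ?thesis
    using h ok children_nodes frontier_nodes by auto
next
  case (QuotTerm u w v)
  assume g: "gate_ok g" and "h \<in> gate_children g"
  with QuotTerm have ok: "u \<in> nodes \<Phi>" "deg v < deg u" "deg u < 2 * deg v"
      "w \<in> frontier ((deg u + deg v) div 2)" "below v w" "below w u"
    and h: "h = Quot u w \<or> (\<exists>c\<in>children \<Phi> w. h = (if below v c then Quot c v else Val c))"
    by auto
  have "deg u < 2 * deg w"
    using frontier_deg[OF ok(4)] ok by simp
  moreover have "c \<in> nodes \<Phi>" "deg c < 2 * deg v" if "c \<in> children \<Phi> w" for c
    using that children_nodes frontier_children[OF ok(4) that] ok by auto
  ultimately show ?thesis
    using h ok by (auto split: if_splits)
next
  case (Val u)
  assume "gate_ok g" "h \<in> gate_children g"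
  with Val show ?thesis
    by (auto split: if_splits)
next
  case (Quot u v)
  assume "gate_ok g" "h \<in> gate_children g"
  with Quot show ?thesis
    using deg_mono[of v u] by (auto split: if_splits)
qed auto

lemma gate_rank_child: "gate_ok g \<Longrightarrow> h \<in> gate_children g \<Longrightarrow> gate_rank h < gate_rank g"
proof (cases g)
  case (Val u)
  assume "h \<in> gate_children g"
  with Val show ?thesis
    using floorlog_half[of "deg u"] by (auto split: if_splits)
next
  case (ValTerm u w)
  assume "gate_ok g" "h \<in> gate_children g"
  with ValTerm have ok: "u \<in> nodes \<Phi>" "w \<in> frontier (deg u div 2)" "below w u"
    and h: "h = Quot u w \<or> (label \<Phi> w = Prod \<and> h \<in> Val ` children \<Phi> w) \<or> h = Leaf w"
    by (auto split: if_splits)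
  have w: "deg u div 2 < deg w" "deg w \<le> deg u"
    using frontier_deg[OF ok(2)] deg_mono[OF ok(3,1)] .
  then have u: "0 < deg u"
    by simp
  have "deg u - deg w \<le> deg u div 2"
    using w by linarith
  from floorlog_half_less[OF u this] have "gate_rank (Quot u w) < gate_rank (ValTerm u w)"
    by simp
  moreover have "gate_rank (Val c) < gate_rank (ValTerm u w)" if "c \<in> children \<Phi> w" for c
    using floorlog_half_less[OF u frontier_children[OF ok(2) that]] by simp
  moreover have "gate_rank (Leaf w) < gate_rank (ValTerm u w)"
    using floorlog_half[OF u] by simp
  ultimately show ?thesis
    using h ValTerm by blast
next
  case (Quot u v)
  assume "h \<in> gate_children g"
  with Quot show ?thesis
    by (auto split: if_splits)
next
  case (QuotTerm u w v)
  assume "gate_ok g" "h \<in> gate_children g"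
  with QuotTerm have ok: "u \<in> nodes \<Phi>" "deg v < deg u" "deg u < 2 * deg v"
      "w \<in> frontier ((deg u + deg v) div 2)" "below v w" "below w u"
    and h: "h = Quot u w \<or> (\<exists>c\<in>children \<Phi> w. h = (if below v c then Quot c v else Val c))"
    by auto
  obtain c0 where c0: "label \<Phi> w = Prod" "c0 \<in> children \<Phi> w" "below v c0"
    using QuotTerm_Prod[of u w v] \<open>gate_ok g\<close> QuotTerm by blast
  have w: "(deg u + deg v) div 2 < deg w" "deg w \<le> deg u"
    using frontier_deg[OF ok(4)] deg_mono[OF ok(6,1)] .
  have uv: "0 < deg u - deg v"
    using ok by simp
  have "deg u - deg w \<le> (deg u - deg v) div 2"
    using w ok(2) by linarith
  from floorlog_half_less[OF uv this] have "gate_rank (Quot u w) < gate_rank (QuotTerm u w v)"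
    by simp
  moreover have "gate_rank (Quot c v) < gate_rank (QuotTerm u w v)" if "c \<in> children \<Phi> w" for c
  proof -
    have "deg c - deg v \<le> (deg u - deg v) div 2"
      using frontier_children[OF ok(4) that] ok(2) by linarith
    from floorlog_half_less[OF uv this] show ?thesis
      by simp
  qed
  \<comment> \<open>This degree need not be halved. The sibling \<open>c0\<close> above
    \<open>v\<close> uses up at least \<open>deg v\<close>, which leaves at most
    \<open>deg u - deg v\<close> for \<open>c\<close>; the offset of \<open>QuotTerm\<close> covers
    the case of equality.\<close>
  moreover have "gate_rank (Val c) < gate_rank (QuotTerm u w v)"
    if "c \<in> children \<Phi> w" "\<not> below v c" for c
  proof -
    have "deg c0 + deg c \<le> deg w"
      using c0 that frontier_nodes[OF ok(4)] by (intro deg_disjoint) auto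
    moreover have "deg v \<le> deg c0"
      using c0 children_nodes deg_mono by blast
    ultimately have "deg c \<le> deg u - deg v"
      using w by linarith
    then show ?thesis
      using floorlog_mono[of "deg c" "deg u - deg v" 2] by simp
  qed
  ultimately show ?thesis
    using h QuotTerm by (auto simp del: gate_rank.simps split: if_splits)
qed simp

text \<open>A childless node counts as a leaf, so a gate labeled \<open>Sum\<close> must have a
  summand.\<close>

lemma Val_frontier_nonempty:
  assumes "u \<in> nodes \<Phi>" "deg u \<noteq> 0"
  shows "{w \<in> frontier (deg u div 2). below w u} \<noteq> {}"
  using below_frontier_exists[of u "deg u div 2"] assms by auto

lemma Quot_frontier_nonempty:
  assumes "gate_ok (Quot u v)" "deg u \<noteq> deg v"
  shows "{w \<in> frontier ((deg u + deg v) div 2). below v w \<and> below w u} \<noteq> {}"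
proof -
  have "deg v < deg u"
    using deg_mono[of v u] assms by simp
  then have "deg v \<le> (deg u + deg v) div 2" "(deg u + deg v) div 2 < deg u"
    by linarith+
  then show ?thesis
    using between_frontier_exists[of u v "(deg u + deg v) div 2"] assms by auto
qed

lemma gate_label_ok:
  "gate_ok g \<Longrightarrow> if gate_children g = {}
     then gate_label g \<in> Var ` input_indices n k \<union> Const ` {0..}
     else gate_label g \<in> {Prod, Sum}"
proof (cases g)
  case (Leaf w)
  assume "gate_ok g"
  then have "w \<in> nodes \<Phi>" "label \<Phi> w \<in> range Var"
    using Leaf by simp_all
  then show ?thesis
    using Leaf by (cases rule: node_cases) auto
next
  case (Val u)
  assume "gate_ok g"
  then show ?thesis
    using Val Val_frontier_nonempty[of u] by (auto simp: val_nonneg)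
next
  case (Quot u v)
  assume "gate_ok g"
  then show ?thesis
    using Quot Quot_frontier_nonempty[of u v] by (auto simp: quot_nonneg)
qed simp_all

lemma gate_scope_Sum: "gate_label g = Sum \<Longrightarrow> gate_ok g \<Longrightarrow> h \<in> gate_children g \<Longrightarrow> gate_scope h = gate_scope g"
proof (cases g)
  case (Leaf w)
  assume "gate_label g = Sum" "gate_ok g"
  with Leaf show ?thesis
    by auto
qed (auto split: if_splits)

lemma gate_scope_rec:
  assumes "gate_ok g"
  shows "gate_scope g = {i. \<exists>j. gate_label g = Var (i, j)} \<union> (\<Union>h\<in>gate_children g. gate_scope h)"
proof (cases g)
  case (Val u)
  show ?thesis
  proof (cases "deg u = 0")
    case True
    then show ?thesis
      using Val assms deg_0_iff[of u] by simp
  next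
    case False
    then show ?thesis
      using Val assms Val_frontier_nonempty[of u] by auto
  qed
next
  case (Leaf w)
  then have "w \<in> nodes \<Phi>" "label \<Phi> w \<in> range Var"
    using assms by simp_all
  then show ?thesis
    by (cases rule: node_cases) (use Leaf dep_scope_rec[of \<Phi> w] in auto)
next
  case (ValTerm u w)
  then have w: "w \<in> frontier (deg u div 2)" and sub: "scope w \<subseteq> scope u"
    using assms by (simp_all add: dep_scope_mono)
  from w show ?thesis
    by (cases rule: frontier_cases) (use ValTerm sub scope_Prod[of w] in auto)
next
  case (Quot u v)
  show ?thesis
  proof (cases "deg u = deg v")
    case True
    have "u \<in> nodes \<Phi>" "below v u"
      using Quot assms by simp_all
    \<comment> \<open>Inclusion and equal degrees force equal scopes, in accordance with the empty
      scope of a constant.\<close>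
    then have "card (scope u - scope v) = 0" "finite (scope u - scope v)"
      using True by (simp_all add: deg_diff finite_scope)
    then show ?thesis
      using Quot True by simp
  next
    case False
    then show ?thesis
      using Quot assms Quot_frontier_nonempty[of u v] by auto
  qed
next
  case (QuotTerm u w v)
  then obtain c where c: "label \<Phi> w = Prod" "c \<in> children \<Phi> w" "below v c"
    using QuotTerm_Prod[of u w v] assms by blast
  have ok: "w \<in> nodes \<Phi>" "0 < deg v" and wu: "scope w \<subseteq> scope u"
    using QuotTerm assms by (auto simp: dep_scope_mono frontier_nodes)
  have vc: "scope v \<subseteq> scope c"
    using c(3) by (rule dep_scope_mono)
  define q where "q = (\<lambda>c. if below v c then Quot c v else Val c)"
  have children: "gate_children g = insert (Quot u w) (q ` children \<Phi> w)"
    by (simp add: QuotTerm q_def)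
  \<comment> \<open>The scope of a child not above \<open>v\<close> is disjoint from
    \<open>scope c\<close>, hence from \<open>scope v\<close>, so subtracting \<open>scope v\<close>
    does not change it.\<close>
  have sub: "gate_scope (q c') = scope c' - scope v"
    if "c' \<in> children \<Phi> w" for c'
  proof (cases "below v c'")
    case False
    then have "scope c \<inter> scope c' = {}"
      using c that ok by (intro scope_disjoint) auto
    then show ?thesis
      using False vc by (auto simp: q_def)
  qed (simp add: q_def)
  have "(\<Union>h\<in>gate_children g. gate_scope h) = (scope u - scope w) \<union> (\<Union>c'\<in>children \<Phi> w. scope c' - scope v)"
    unfolding children using sub by simp
  also have "\<dots> = (scope u - scope w) \<union> (scope w - scope v)"
    using scope_Prod[OF c(1)] by blast
  also have "\<dots> = scope u - scope v"
    using wu vc scope_child[OF c(2)] by blast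
  finally show ?thesis
    using QuotTerm by simp
qed

text \<open>The quotient by \<open>w\<close> has its scope outside \<open>scope w\<close>, while the
  other factors have theirs inside it and belong to different children of the product node
  \<open>w\<close>, or to \<open>w\<close> itself if it is a leaf.\<close>

lemma gate_scope_disjoint:
  assumes "gate_ok g" "gate_label g = Prod"
  shows "disjoint_family_on gate_scope (gate_children g)"
proof (cases g)
  case (ValTerm u w)
  then have w: "w \<in> frontier (deg u div 2)"
    using assms by simp
  have sub: "scope c \<subseteq> scope w" if "c \<in> children \<Phi> w" for c
    using that by (rule scope_child)
  have dis: "scope c \<inter> scope c' = {}"
    if "label \<Phi> w = Prod" "c \<in> children \<Phi> w" "c' \<in> children \<Phi> w" "c \<noteq> c'" for c c'
    using scope_disjoint[OF frontier_nodes[OF w]] that by blast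
  show ?thesis
    using ValTerm sub dis by (auto simp: disjoint_family_on_def)
next
  case (QuotTerm u w v)
  then obtain c where c: "label \<Phi> w = Prod" "c \<in> children \<Phi> w" "below v c"
    using QuotTerm_Prod[of u w v] assms by blast
  have w: "w \<in> nodes \<Phi>"
    using QuotTerm assms by (auto simp: frontier_nodes)
  define q where "q = (\<lambda>c. if below v c then Quot c v else Val c)"
  have q: "gate_scope (q c) \<subseteq> scope c" "gate_scope (q c) \<subseteq> scope w" if "c \<in> children \<Phi> w" for c
    using scope_child[OF that] by (auto simp: q_def)
  have dis: "scope c \<inter> scope c' = {}" if "c \<in> children \<Phi> w" "c' \<in> children \<Phi> w" "c \<noteq> c'" for c c'
    using scope_disjoint[OF w c(1)] that by blast
  show ?thesis
    unfolding disjoint_family_on_def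
  proof (intro ballI impI)
    fix h h' assume h: "h \<in> gate_children g" "h' \<in> gate_children g" "h \<noteq> h'"
    from h QuotTerm have "h \<in> insert (Quot u w) (q ` children \<Phi> w)" "h' \<in> insert (Quot u w) (q ` children \<Phi> w)"
      by (simp_all add: q_def)
    then consider "h = Quot u w" "\<exists>c\<in>children \<Phi> w. h' = q c" | "h' = Quot u w" "\<exists>c\<in>children \<Phi> w. h = q c"
      | c c' where "c \<in> children \<Phi> w" "c' \<in> children \<Phi> w" "h = q c" "h' = q c'"
      using h(3) by blast
    then show "gate_scope h \<inter> gate_scope h' = {}"
    proof cases
      case (3 c c')
      then show ?thesis
        using q(1)[of c] q(1)[of c'] dis[of c c'] h(3) by blast
    qed (use q(2) in fastforce)+
  qed
qed (use assms in \<open>auto split: if_splits\<close>)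

text \<open>The sum gates are the two expansions. Children form a set, so a product gate has the
  right value only if its factors are pairwise different gates.\<close>

lemma gate_val_rec:
  assumes "gate_ok g"
  shows "gate_val a g = (case gate_label g of
      Var y \<Rightarrow> a y
    | Const c \<Rightarrow> c
    | Prod \<Rightarrow> (\<Prod>h\<in>gate_children g. gate_val a h)
    | Sum \<Rightarrow> (\<Sum>h\<in>gate_children g. gate_val a h))"
proof (cases g)
  case (Val u)
  then have u: "u \<in> nodes \<Phi>"
    using assms by simp
  show ?thesis
  proof (cases "deg u = 0")
    case True
    then show ?thesis
      using Val val_cong[OF u] deg_0_iff[OF u] by simp
  next
    case False
    then show ?thesis
      using Val val_expansion[OF u, of "deg u div 2"]
      by (simp add: sum.reindex inj_on_def)
  qed
next
  case (Leaf w)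
  then have "w \<in> nodes \<Phi>" "label \<Phi> w \<in> range Var"
    using assms by simp_all
  then show ?thesis
    by (cases rule: node_cases) (use Leaf val_rec[of a w] in auto)
next
  case (ValTerm u w)
  then have "w \<in> frontier (deg u div 2)"
    using assms by simp
  then show ?thesis
  proof (cases rule: frontier_cases)
    case 1
    have "(\<Prod>h\<in>gate_children g. gate_val a h) = quot a u w * (\<Prod>h\<in>Val ` children \<Phi> w. gate_val a h)"
      using ValTerm 1 by (simp, subst prod.insert) (auto simp: finite_children)
    also have "\<dots> = quot a u w * val a w"
      using 1 val_rec[of a w] by (simp add: prod.reindex inj_on_def)
    finally show ?thesis
      using ValTerm by simp
  next
    case 2
    then show ?thesis
      using ValTerm by simp
  qed
next
  case (Quot u v)
  then have ok: "u \<in> nodes \<Phi>" "below v u" "deg u < 2 * deg v"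
    using assms by simp_all
  show ?thesis
  proof (cases "deg u = deg v")
    case True
    have "card (scope u - scope v) = 0" "finite (scope u - scope v)"
      using True ok by (simp_all add: deg_diff finite_scope)
    then have "scope u \<subseteq> scope v"
      by simp
    then show ?thesis
      using Quot True ok quot_cong[OF ok(1)] by simp
  next
    case False
    have "deg v < deg u"
      using False deg_mono[OF ok(2,1)] by simp
    then show ?thesis
      using Quot False quot_expansion[OF ok(1) _ _ ok(3), of "(deg u + deg v) div 2"]
      by (simp add: sum.reindex inj_on_def)
  qed
next
  case (QuotTerm u w v)
  then obtain c where c: "label \<Phi> w = Prod" "c \<in> children \<Phi> w" "below v c"
    using QuotTerm_Prod[of u w v] assms by blast
  have "below w u" and ne: "w \<noteq> v"
    using QuotTerm assms not_below_child c by auto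
  define q where "q = (\<lambda>c. if below v c then Quot c v else Val c)"
  have children: "gate_children g = insert (Quot u w) (q ` children \<Phi> w)"
    by (simp add: QuotTerm q_def)
  \<comment> \<open>\<open>Quot u w\<close> could coincide with a factor \<open>Quot c v\<close>
    only for \<open>c = u\<close>, which acyclicity excludes.\<close>
  have "u \<notin> children \<Phi> w"
    using \<open>below w u\<close> not_below_child by blast
  then have notin: "Quot u w \<notin> q ` children \<Phi> w"
    by (auto simp: q_def split: if_splits)
  have inj: "inj_on q (children \<Phi> w)"
    by (auto simp: inj_on_def q_def split: if_splits)
  have "(\<Prod>h\<in>gate_children g. gate_val a h) = quot a u w * (\<Prod>h\<in>q ` children \<Phi> w. gate_val a h)"
    unfolding children using notin finite_children by simp
  also have "(\<Prod>h\<in>q ` children \<Phi> w. gate_val a h) = (\<Prod>c\<in>children \<Phi> w. if below v c then quot a c v else val a c)"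
    using inj by (simp add: prod.reindex) (auto simp: q_def intro: prod.cong)
  also have "\<dots> = quot a w v"
    using c ne by (subst quot_rec, unfold quot_step_def) auto
  finally show ?thesis
    using QuotTerm by simp
qed

text \<open>There are five kinds of gates, each indexed by at most three nodes;
  \<open>QuotTerm\<close> is the kind that makes the count cubic.\<close>

lemma gates_card: "finite {g. gate_ok g}" "card {g. gate_ok g} \<le> 5 * circuit_size \<Phi> ^ 3"
proof -
  let ?V = "nodes \<Phi>"
  define s where "s = card ?V"
  define G1 where "G1 = Val ` ?V"
  define G2 where "G2 = Leaf ` ?V"
  define G3 where "G3 = (\<lambda>(u, w). ValTerm u w) ` (?V \<times> ?V)"
  define G4 where "G4 = (\<lambda>(u, v). Quot u v) ` (?V \<times> ?V)"
  define G5 where "G5 = (\<lambda>(u, w, v). QuotTerm u w v) ` (?V \<times> ?V \<times> ?V)"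
  note G = G1_def G2_def G3_def G4_def G5_def
  have fin: "finite G1" "finite G2" "finite G3" "finite G4" "finite G5"
    using finite_nodes by (simp_all add: G)
  have "g \<in> G1 \<union> G2 \<union> G3 \<union> G4 \<union> G5" if "gate_ok g" for g
  proof (cases g)
    case (QuotTerm u w v)
    then have "u \<in> ?V" "w \<in> ?V" "v \<in> ?V"
      using that below_nodes[of v w] frontier_nodes[of w] by auto
    then show ?thesis
      using QuotTerm by (force simp: G)
  next
    case (ValTerm u w)
    then have "u \<in> ?V" "w \<in> ?V"
      using that frontier_nodes[of w] by auto
    then show ?thesis
      using ValTerm by (force simp: G)
  next
    case (Quot u v)
    then have "u \<in> ?V" "v \<in> ?V"
      using that below_nodes[of v u] by auto
    then show ?thesis
      using Quot by (force simp: G)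
  qed (use that in \<open>auto simp: G\<close>)
  then have sub: "{g. gate_ok g} \<subseteq> G1 \<union> G2 \<union> G3 \<union> G4 \<union> G5"
    by blast
  show "finite {g. gate_ok g}"
    by (rule finite_subset[OF sub]) (use fin in simp)
  have "card {g. gate_ok g} \<le> card (G1 \<union> G2 \<union> G3 \<union> G4 \<union> G5)"
    using fin by (intro card_mono sub) simp
  also have "\<dots> \<le> card G1 + card G2 + card G3 + card G4 + card G5"
    by (intro order_trans[OF card_Un_le] add_right_mono order_refl)
  also have "\<dots> \<le> s + s + s * s + s * s + s * (s * s)"
    unfolding G s_def
    by (intro add_mono order_trans[OF card_image_le]) (simp_all add: finite_nodes card_cartesian_product)
  also have "\<dots> \<le> 5 * s ^ 3"
  proof (cases "s = 0")
    case False
    then have "s \<le> s ^ 3" "s * s \<le> s ^ 3"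
      by (simp_all add: power3_eq_cube)
    moreover have "s * (s * s) = s ^ 3"
      by (simp add: power3_eq_cube)
    ultimately show ?thesis
      by linarith
  qed simp
  finally show "card {g. gate_ok g} \<le> 5 * circuit_size \<Phi> ^ 3"
    by (simp add: s_def circuit_size_def)
qed

section \<open>Assembly and final bounds\<close>

lemma root_in_nodes: "root \<Phi> \<in> nodes \<Phi>"
proof -
  have "\<exists>!u. is_root \<Phi> u"
    using arith by (simp add: arithmetic_circuit_def)
  then have "is_root \<Phi> (root \<Phi>)"
    unfolding root_def by (rule theI')
  then show ?thesis
    by (simp add: is_root_def)
qed

end

text \<open>The depth is bounded by the rank of the \<open>Val\<close> gate at the root, whose
  degree is at most \<open>n\<close>. Agreement at every assignment gives agreement for all input
  functions.\<close>

theorem balanced_dc_spn: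
  fixes \<Phi> :: "('v::countable, nat \<times> nat) circuit"
  assumes "dc_spn n k \<Phi>"
  shows "\<exists>\<Psi> :: (nat, nat \<times> nat) circuit. dc_spn n k \<Psi> \<and> circuit_size \<Psi> \<le> 5 * circuit_size \<Phi> ^ 3 \<and>
    circuit_depth \<Psi> \<le> 4 * floorlog 2 n \<and>
    (\<forall>a. mpoly_eval (circuit_poly \<Psi>) a = mpoly_eval (circuit_poly \<Phi>) a)"
proof -
  interpret dc_circuit n k \<Phi>
    by standard (rule assms)
  have "\<exists>\<Psi> :: (nat, nat \<times> nat) circuit. dc_spn n k \<Psi> \<and> circuit_size \<Psi> \<le> card {g. gate_ok g} \<and>
    circuit_depth \<Psi> \<le> gate_rank (Val (root \<Phi>)) \<and>
    (\<forall>a. mpoly_eval (circuit_poly \<Psi>) a = gate_val a (Val (root \<Phi>)))"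
  proof (rule spn_of_gates[where ch = gate_children and lab = gate_label and sc = gate_scope])
    show "disjoint_family_on gate_scope (gate_children g)" if "g \<in> {g. gate_ok g}" "gate_label g = Prod" for g
      using that gate_scope_disjoint by blast
    show "gate_scope h = gate_scope g" if "g \<in> {g. gate_ok g}" "gate_label g = Sum" "h \<in> gate_children g" for g h
      using that gate_scope_Sum by blast
    show "gate_scope g = {i. \<exists>j. gate_label g = Var (i, j)} \<union> (\<Union>h\<in>gate_children g. gate_scope h)"
      if "g \<in> {g. gate_ok g}" for g
      using that by (intro gate_scope_rec) simp
    show "h \<in> {g. gate_ok g}" if "g \<in> {g. gate_ok g}" "h \<in> gate_children g" for g h
      using that gate_ok_child by blast
    show "gate_rank h < gate_rank g" if "g \<in> {g. gate_ok g}" "h \<in> gate_children g" for g h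
      using that gate_rank_child by blast
    show "if gate_children g = {} then gate_label g \<in> Var ` input_indices n k \<union> Const ` {0..}
        else gate_label g \<in> {Prod, Sum}" if "g \<in> {g. gate_ok g}" for g
      using that by (intro gate_label_ok) simp
    show "gate_val a g = (case gate_label g of Var y \<Rightarrow> a y | Const c \<Rightarrow> c
        | Prod \<Rightarrow> prod (gate_val a) (gate_children g) | Sum \<Rightarrow> sum (gate_val a) (gate_children g))"
      if "g \<in> {g. gate_ok g}" for a g
      using that by (intro gate_val_rec) simp
  qed (use gates_card(1) root_in_nodes in auto)
  then obtain \<Psi> :: "(nat, nat \<times> nat) circuit" where \<Psi>: "dc_spn n k \<Psi>"
    "circuit_size \<Psi> \<le> card {g. gate_ok g}" "circuit_depth \<Psi> \<le> gate_rank (Val (root \<Phi>))"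
    "\<forall>a. mpoly_eval (circuit_poly \<Psi>) a = gate_val a (Val (root \<Phi>))"
    by blast
  have "gate_rank (Val (root \<Phi>)) \<le> 4 * floorlog 2 n"
    using deg_le[OF root_in_nodes] by (simp add: floorlog_mono)
  then have "circuit_depth \<Psi> \<le> 4 * floorlog 2 n"
    using \<Psi>(3) by linarith
  moreover have "circuit_size \<Psi> \<le> 5 * circuit_size \<Phi> ^ 3"
    using \<Psi>(2) gates_card(2) by linarith
  moreover have "\<forall>a. mpoly_eval (circuit_poly \<Psi>) a = mpoly_eval (circuit_poly \<Phi>) a"
    using \<Psi>(4) by (simp add: circuit_poly_def node_val_def)
  ultimately show ?thesis
    using \<Psi>(1) by blast
qed

text \<open>\<open>floorlog\<close> is the floor of the logarithm plus 1; with the argument raised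
  to at least 2 the logarithm is at least 1 and absorbs this summand.\<close>

lemma floorlog_le_log: "1 \<le> n \<Longrightarrow> real (floorlog 2 n) \<le> 2 * log 2 (real (max 2 n))"
proof -
  assume n: "1 \<le> n"
  have "real (floorlog 2 n) = real_of_int \<lfloor>log 2 (real n)\<rfloor> + 1"
    using n by (simp add: floorlog_def)
  also have "\<dots> \<le> log 2 (real n) + 1"
    by simp
  also have "log 2 (real n) \<le> log 2 (real (max 2 n))"
    using n by simp
  also have "1 \<le> log 2 (real (max 2 n))"
    using log_mono[of 2 2 "real (max 2 n)"] by simp
  finally show ?thesis
    by simp
qed

text \<open>Settles size 1, where \<open>log 2 s = 0\<close> leaves no room for depth: acyclicity
  excludes the only possible edge, a loop.\<close>

lemma circuit_depth_singleton:
  assumes "arithmetic_circuit Y \<Phi>" "circuit_size \<Phi> = 1"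
  shows "circuit_depth \<Phi> \<le> 0"
proof -
  obtain r where r: "nodes \<Phi> = {r}"
    using assms(2) by (auto simp: circuit_size_def card_1_singleton_iff)
  have "edges \<Phi> \<subseteq> {(r, r)}" "(r, r) \<notin> edges \<Phi>"
    using assms(1) r by (auto simp: arithmetic_circuit_def acyclic_def)
  then have "edges \<Phi> = {}"
    by blast
  then show ?thesis
    using r by (intro circuit_depth_le[where rk = "\<lambda>_. 0"]) auto
qed

theorem corollary33:
  shows "\<exists>C::real. C > 0 \<and>
    (\<forall>(n::nat) (R :: nat \<Rightarrow> real set) (M :: nat \<Rightarrow> real measure) (k :: nat \<Rightarrow> nat)
      (f :: nat \<Rightarrow> nat \<Rightarrow> real \<Rightarrow> real) (\<Phi> :: (nat, nat \<times> nat) circuit) (s::nat).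
      1 \<le> n \<longrightarrow> input_functions n R M k f \<longrightarrow> dc_spn n k \<Phi> \<longrightarrow> circuit_size \<Phi> = s \<longrightarrow>
      (\<exists>\<Psi> :: (nat, nat \<times> nat) circuit.
         dc_spn n k \<Psi> \<and>
         real (circuit_size \<Psi>) \<le> C * real s ^ 3 \<and>
         real (circuit_depth \<Psi>) \<le> C * (log 2 (real (max 2 n)) * log 2 (real s)) \<and>
         (\<forall>x \<in> (\<Pi>\<^sub>E i\<in>{1..n}. R i). spn_fun f \<Psi> x = spn_fun f \<Phi> x)))"
\<comment> \<open>The constant is \<open>4 * 2\<close>: four ranks per bit, and a factor 2 from
  \<open>floorlog_le_log\<close>. It also covers the factor 5 of the size bound.\<close>
proof (rule exI[of _ 8], intro conjI allI impI)
  fix n :: nat and R :: "nat \<Rightarrow> real set" and M :: "nat \<Rightarrow> real measure" and k :: "nat \<Rightarrow> nat"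
    and f :: "nat \<Rightarrow> nat \<Rightarrow> real \<Rightarrow> real" and \<Phi> :: "(nat, nat \<times> nat) circuit" and s :: nat
  assume n: "1 \<le> n" and \<Phi>: "dc_spn n k \<Phi>" and s: "circuit_size \<Phi> = s"
  have arith: "arithmetic_circuit (input_indices n k) \<Phi>"
    using \<Phi> by (simp add: dc_spn_def spn_def)
  then obtain r where "r \<in> nodes \<Phi>" "finite (nodes \<Phi>)"
    by (auto simp: arithmetic_circuit_def is_root_def)
  then have "s \<noteq> 0"
    using s card_gt_0_iff[of "nodes \<Phi>"] by (auto simp: circuit_size_def)
  then consider "s = 1" | "2 \<le> s"
    by linarith
  then show "\<exists>\<Psi> :: (nat, nat \<times> nat) circuit. dc_spn n k \<Psi> \<and>
      real (circuit_size \<Psi>) \<le> 8 * real s ^ 3 \<and>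
      real (circuit_depth \<Psi>) \<le> 8 * (log 2 (real (max 2 n)) * log 2 (real s)) \<and>
      (\<forall>x \<in> (\<Pi>\<^sub>E i\<in>{1..n}. R i). spn_fun f \<Psi> x = spn_fun f \<Phi> x)"
  proof cases
    case 1
    then show ?thesis
      using \<Phi> s circuit_depth_singleton[OF arith] by (intro exI[of _ \<Phi>]) simp
  next
    case 2
    obtain \<Psi> :: "(nat, nat \<times> nat) circuit" where \<Psi>: "dc_spn n k \<Psi>" "circuit_size \<Psi> \<le> 5 * s ^ 3"
      "circuit_depth \<Psi> \<le> 4 * floorlog 2 n"
      "\<forall>a. mpoly_eval (circuit_poly \<Psi>) a = mpoly_eval (circuit_poly \<Phi>) a"
      using balanced_dc_spn[OF \<Phi>] s by blast
    have "real (circuit_size \<Psi>) \<le> real (5 * s ^ 3)"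
      using \<Psi>(2) by (rule of_nat_mono)
    also have "\<dots> \<le> 8 * real s ^ 3"
      by simp
    finally have size: "real (circuit_size \<Psi>) \<le> 8 * real s ^ 3" .
    have "real (circuit_depth \<Psi>) \<le> real (4 * floorlog 2 n)"
      using \<Psi>(3) by (rule of_nat_mono)
    also have "\<dots> \<le> 8 * (log 2 (real (max 2 n)) * 1)"
      using floorlog_le_log[OF n] by simp
    \<comment> \<open>From \<open>2 \<le> s\<close> the inserted factor \<open>log 2 s\<close> is at
      least 1.\<close>
    also have "\<dots> \<le> 8 * (log 2 (real (max 2 n)) * log 2 (real s))"
      using 2 log_mono[of 2 2 "real s"] by (intro mult_left_mono) auto
    finally have "real (circuit_depth \<Psi>) \<le> 8 * (log 2 (real (max 2 n)) * log 2 (real s))" .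
    with size \<Psi>(1,4) show ?thesis
      by (intro exI[of _ \<Psi>]) (simp add: spn_fun_def)
  qed
qed simp

end
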